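(* Let $\{\boldsymbol X^{(k)}\}_{k=0}^\infty\subset\mathbb R^{n_1\times n_2}$ be the sequence of matrices generated by the iterative hard-thresholded SVD (IHTSVD) iteration $$\boldsymbol X^{(k+1)}=\mathcal P_{\bar\Omega}\bigl(\mathcal P_r(\boldsymbol X^{(k)})\bigr)+\mathcal P_\Omega(\boldsymbol M)\quad\text{for all integers } k\ge 0,$$ and suppose that $\boldsymbol X^{(0)}$ satisfies $$\|\boldsymbol X^{(0)}-\boldsymbol M\|_F<\frac{\lambda_{\min}(\boldsymbol H)}{c_1}\,\sigma_r ,$$ where $\boldsymbol H$ is the $(n_1n_2-s)\times(n_1n_2-s)$ matrix $$\boldsymbol H=\boldsymbol S_{\bar\Omega}^\top(\boldsymbol P_{\boldsymbol V_\perp}\otimes\boldsymbol P_{\boldsymbol U_\perp})\boldsymbol S_{\bar\Omega}$$ and $\lambda_{\min}(\boldsymbol H)$ is its smallest eigenvalue. Then $\|\boldsymbol X^{(k)}-\boldsymbol M\|_F$ converges asymptotically at the linear rate $$\rho=1-\lambda_{\min}(\boldsymbol H).$$ Specifically, for any $\epsilon>0$, one has $\|\boldsymbol X^{(k)}-\boldsymbol M\|_F\le\epsilon\|\boldsymbol X^{(0)}-\boldsymbol M\|_F$ for all integers $k$ such that $$k\ge K(\epsilon)=\frac{\log(1/\epsilon)}{\log\bigl(1/(1-\lambda_{\min}(\boldsymbol H))\bigr)}+c,$$ where $\tau=\dfrac{c_1\|\boldsymbol X^{(0)}-\boldsymbol M\|_F}{\sigma_r\lambda_{\min}(\boldsymbol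 H)}$ and $$c=\frac{1}{\rho\log(1/\rho)}\left(E_1\Bigl(\log\frac{1}{\rho+\tau(1-\rho)}\Bigr)-E_1\Bigl(\log\frac1\rho\Bigr)+\frac12\log\left(\frac{\log(1/\rho)}{\log\bigl(1/(\rho+\tau(1-\rho))\bigr)}\right)\right)+1,$$ with $E_1(t)=\int_t^\infty\frac{e^{-z}}{z}\,dz$ the exponential integral.
   Context: $\boldsymbol M\in\mathbb R^{n_1\times n_2}$ is a matrix of rank $r$, $1\le r\le m=\min\{n_1,n_2\}$, with compact singular value decomposition $\boldsymbol M=\sum_{i=1}^r\sigma_i\boldsymbol u_i\boldsymbol v_i^\top$, $\sigma_1\ge\dots\ge\sigma_r>0$. Set $\boldsymbol P_{\boldsymbol U_\perp}=\boldsymbol I_{n_1}-\sum_{i=1}^r\boldsymbol u_i\boldsymbol u_i^\top$ and $\boldsymbol P_{\boldsymbol V_\perp}=\boldsymbol I_{n_2}-\sum_{i=1}^r\boldsymbol v_i\boldsymbol v_i^\top$. $\Omega\subset[n_1]\times[n_2]$ has cardinality $s$ with $1\le s<n_1n_2$, and $\bar\Omega$ is its complement. $\mathcal P_\Omega$ is the linear operator on $\mathbb R^{n_1\times n_2}$ that keeps the entries indexed by $\Omega$ and sets all other entries to $0$; $\mathcal P_{\bar\Omega}$ is defined likewise with $\bar\Omega$. $\mathrm{vec}$ stacks the columns of a matrix. $\boldsymbol S_{\bar\Omega}\in\mathbb R^{n_1n_2\times(n_1n_2-s)}$ is the selection matrix for $\bar\Omega$: its columns are a subset of the columns of $\boldsymbol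 I_{n_1n_2}$, with $\boldsymbol S_{\bar\Omega}^\top\boldsymbol S_{\bar\Omega}=\boldsymbol I_{n_1n_2-s}$ and $\mathrm{vec}(\mathcal P_{\bar\Omega}(\boldsymbol X))=\boldsymbol S_{\bar\Omega}\boldsymbol S_{\bar\Omega}^\top\mathrm{vec}(\boldsymbol X)$ for all $\boldsymbol X$. $\otimes$ is the Kronecker product and $\|\cdot\|_F$ the Frobenius norm. Rank-$r$ projection: for $\boldsymbol X$ with singular value decomposition $\boldsymbol X=\sum_{i=1}^m\sigma_i(\boldsymbol X)\boldsymbol u_i(\boldsymbol X)\boldsymbol v_i(\boldsymbol X)^\top$, $\sigma_1(\boldsymbol X)\ge\dots\ge\sigma_m(\boldsymbol X)\ge0$, put $\mathcal P_r(\boldsymbol X)=\sum_{i=1}^r\sigma_i(\boldsymbol X)\boldsymbol u_i(\boldsymbol X)\boldsymbol v_i(\boldsymbol X)^\top$. Constant $c_1$ (known perturbation result): $c_1$ is a universal constant with $1+1/\sqrt2\le c_1\le4(1+\sqrt2)$ such that for every $\boldsymbol\Delta\in\mathbb R^{n_1\times n_2}$, $\mathcal P_r(\boldsymbol M+\boldsymbol\Delta)=\boldsymbol M+\boldsymbol\Delta-\boldsymbol P_{\boldsymbol U_\perp}\boldsymbol\Delta\boldsymbol P_{\boldsymbol V_\perp}+\boldsymbol R(\boldsymbol\Delta)$ with $\|\boldsymbol R(\boldsymbol\Delta)\|_F\le\frac{c_1}{\sigma_r}\|\boldsymbol\Delta\|_F^2$. *)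

theory Defs
  imports "HOL-Analysis.Analysis"
begin

text \<open>
  An \<open>n1 \<times> n2\<close> real matrix has type \<open>real ^ 'n2 ^ 'n1\<close>, with \<open>n1 = CARD('n1)\<close> and
  \<open>n2 = CARD('n2)\<close>. The library norm on this type is the Frobenius norm:
\<close>

lemma norm_matrix_eq_frobenius:
  fixes A :: "real ^ 'n2 ^ 'n1"
  shows "norm A = sqrt (\<Sum>i\<in>UNIV. \<Sum>j\<in>UNIV. (A $ i $ j)\<^sup>2)"
  by (simp add: norm_vec_def L2_set_def sum_nonneg)

definition outer :: "real ^ 'm \<Rightarrow> real ^ 'n \<Rightarrow> real ^ 'n ^ 'm" where
  "outer x y = (\<chi> i j. x $ i * y $ j)"

definition orthonormal_upto :: "nat \<Rightarrow> (nat \<Rightarrow> real ^ 'n) \<Rightarrow> bool" where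
  "orthonormal_upto q w \<longleftrightarrow>
     (\<forall>i\<in>{1..q}. \<forall>j\<in>{1..q}. w i \<bullet> w j = (if i = j then 1 else 0))"

text \<open>
  With \<open>q = min n1 n2\<close> this is a (thin) singular value decomposition; with \<open>q\<close> the rank and
  positive singular values it is a compact one. Families are indexed by \<open>1, \<dots>, q\<close>, and their
  values elsewhere are irrelevant.
\<close>

definition is_svd ::
  "nat \<Rightarrow> real ^ 'n2 ^ 'n1 \<Rightarrow> (nat \<Rightarrow> real) \<Rightarrow> (nat \<Rightarrow> real ^ 'n1) \<Rightarrow> (nat \<Rightarrow> real ^ 'n2) \<Rightarrow> bool"
where
  "is_svd q X \<sigma> u v \<longleftrightarrow>
     orthonormal_upto q u \<and> orthonormal_upto q v \<and>
     (\<forall>i\<in>{1..q}. 0 \<le> \<sigma> i) \<and>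
     (\<forall>i\<in>{1..q}. \<forall>j\<in>{1..q}. i \<le> j \<longrightarrow> \<sigma> j \<le> \<sigma> i) \<and>
     X = (\<Sum>i = 1..q. \<sigma> i *\<^sub>R outer (u i) (v i))"

definition is_compact_svd ::
  "nat \<Rightarrow> real ^ 'n2 ^ 'n1 \<Rightarrow> (nat \<Rightarrow> real) \<Rightarrow> (nat \<Rightarrow> real ^ 'n1) \<Rightarrow> (nat \<Rightarrow> real ^ 'n2) \<Rightarrow> bool"
where
  "is_compact_svd r X \<sigma> u v \<longleftrightarrow> is_svd r X \<sigma> u v \<and> (\<forall>i\<in>{1..r}. 0 < \<sigma> i)"

text \<open>
  The truncated singular value decomposition depends on the chosen decomposition when the
  \<open>r\<close>-th and \<open>(r+1)\<close>-st singular values of \<open>X\<close> coincide. Hence a rank-\<open>r\<close> projection is any map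
  that truncates some singular value decomposition of each matrix.
\<close>

definition is_rank_projection ::
  "nat \<Rightarrow> (real ^ 'n2 ^ 'n1 \<Rightarrow> real ^ 'n2 ^ 'n1) \<Rightarrow> bool"
where
  "is_rank_projection r Pr \<longleftrightarrow>
     (\<forall>X. \<exists>\<sigma> u v. is_svd (min CARD('n1) CARD('n2)) X \<sigma> u v \<and>
                  Pr X = (\<Sum>i = 1..r. \<sigma> i *\<^sub>R outer (u i) (v i)))"

definition orth_complement_proj :: "nat \<Rightarrow> (nat \<Rightarrow> real ^ 'n) \<Rightarrow> real ^ 'n ^ 'n" where
  "orth_complement_proj r w = mat 1 - (\<Sum>i = 1..r. outer (w i) (w i))"

definition entry_proj :: "('n1 \<times> 'n2) set \<Rightarrow> real ^ 'n2 ^ 'n1 \<Rightarrow> real ^ 'n2 ^ 'n1" where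
  "entry_proj \<Omega> X = (\<chi> i j. if (i, j) \<in> \<Omega> then X $ i $ j else 0)"

text \<open>
  Stacked columns are indexed by pairs (column, row), so that the Kronecker product below
  satisfies \<open>vec (A X B\<^sup>T) = (B \<otimes> A) vec X\<close>.
\<close>

definition vectorize :: "real ^ 'n2 ^ 'n1 \<Rightarrow> real ^ ('n2 \<times> 'n1)" where
  "vectorize X = (\<chi> p. X $ snd p $ fst p)"

definition kronecker ::
  "real ^ 'b ^ 'a \<Rightarrow> real ^ 'd ^ 'c \<Rightarrow> real ^ ('b \<times> 'd) ^ ('a \<times> 'c)"
where
  "kronecker A B = (\<chi> p q. A $ fst p $ fst q * B $ snd p $ snd q)"

definition is_selection_matrix ::
  "('n1::finite \<times> 'n2::finite) set \<Rightarrow> real ^ 'p ^ ('n2 \<times> 'n1) \<Rightarrow> bool"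
where
  "is_selection_matrix \<Omega> S \<longleftrightarrow>
     (\<forall>k. \<exists>a. column k S = column a (mat 1)) \<and>
     transpose S ** S = mat 1 \<and>
     (\<forall>X. vectorize (entry_proj \<Omega> X) = (S ** transpose S) *v vectorize X)"

definition is_eigenvalue :: "real ^ 'n ^ 'n \<Rightarrow> real \<Rightarrow> bool" where
  "is_eigenvalue A \<mu> \<longleftrightarrow> (\<exists>x. x \<noteq> 0 \<and> A *v x = \<mu> *\<^sub>R x)"

definition min_eigenvalue :: "real ^ 'n ^ 'n \<Rightarrow> real" where
  "min_eigenvalue A = (LEAST \<mu>. is_eigenvalue A \<mu>)"

definition exp_integral_E1 :: "real \<Rightarrow> real" where
  "exp_integral_E1 t = integral {t..} (\<lambda>z. exp (- z) / z)"

definition rate_offset :: "real \<Rightarrow> real \<Rightarrow> real" where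
  "rate_offset \<rho> \<tau> =
     1 / (\<rho> * ln (1 / \<rho>)) *
       (exp_integral_E1 (ln (1 / (\<rho> + \<tau> * (1 - \<rho>)))) - exp_integral_E1 (ln (1 / \<rho>))
        + 1 / 2 * ln (ln (1 / \<rho>) / ln (1 / (\<rho> + \<tau> * (1 - \<rho>))))) + 1"

text \<open>
  The errors \<open>a k\<close> tend to \<open>0\<close> and the limit superior of the quotients \<open>a (k+1) / a k\<close> is at
  most \<open>\<rho>\<close> (stated without division, as the errors may vanish).
\<close>

definition asymptotically_linear :: "real \<Rightarrow> (nat \<Rightarrow> real) \<Rightarrow> bool" where
  "asymptotically_linear \<rho> a \<longleftrightarrow>
     a \<longlonglongrightarrow> 0 \<and> (\<forall>q > \<rho>. \<forall>\<^sub>F k in sequentially. a (Suc k) \<le> q * a k)"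

end

theory Submission
  imports Defs
begin

text \<open>
  Write \<open>P\<close> for the map sending \<open>W\<close> to \<open>PU W PV\<close>, and \<open>\<lambda>\<close> for the smallest eigenvalue of \<open>H\<close>, so that
  \<open>\<parallel>P W\<parallel>\<^sup>2 \<ge> \<lambda> \<parallel>W\<parallel>\<^sup>2\<close> whenever \<open>W\<close> vanishes on \<open>\<Omega>\<close>. From the first iterate on, the error vanishes on
  \<open>\<Omega>\<close>, where the linear part of the iteration contracts by \<open>\<rho> = 1 - \<lambda>\<close>; hence the scaled error \<open>b\<close>
  satisfies \<open>b (k + 1) \<le> b k (\<rho> + (1 - \<rho>) b k)\<close>, and a Lyapunov function together with an integral
  estimate gives the explicit rate.

  The initial error need not vanish on \<open>\<Omega>\<close>, and there the linear part only contracts by \<open>\<surd>\<rho>\<close>, which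
  together with the given remainder bound does not even keep the iterates inside the ball. The first
  step is therefore treated by a sharper perturbation bound for the truncated singular value
  decomposition, which shows that the first step does not increase the error; the summand \<open>1\<close> in the
  offset pays for this step.
\<close>

section \<open>Singular value decompositions and orthogonal projections\<close>

text \<open>The factor \<rho> arises as a square root taken twice. A matrix \<open>W\<close> that
  vanishes on \<Omega> has a tangent part \<open>W - P W\<close> of norm at most
  \<open>sqrt \<rho> * norm W\<close>, and restricting a tangent matrix to the complement of
  \<Omega> costs another \<open>sqrt \<rho>\<close>. An arbitrary initial error has only the second
  of these.

  In the first step, let \<open>Y\<close> be the truncation of \<open>X 0\<close> and \<delta> the
  initial error. Both the normal part of \<open>Y - M\<close> and the root of the excess of its
  squared norm over \<open>\<delta>^2\<close> are at most
  \<open>k = c1 * \<delta>^2 / (2 * \<sigma> r)\<close>, half of the given remainder bound. The half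
  is decisive: inside the ball \<open>k\<close> is below \<open>\<lambda> * \<delta> / 2\<close>,
  and \<open>\<lambda> / 2 \<le> 1 - sqrt \<rho>\<close>, while
  \<open>\<lambda> \<le> 1 - sqrt \<rho>\<close> fails for \<open>0 < \<rho> < 1\<close>.

  The offset pays for \<open>ln (1 / (1 - \<tau>)) / \<rho>\<close>, the logarithm of the factor in
  the Lyapunov function at the start. Here \<open>ln (1 / (1 - \<tau>))\<close> is the integral of
  \<open>1 / (exp z - 1)\<close> from \<open>ln (1 / (\<rho> + \<tau> * (1 - \<rho>)))\<close> to
  \<open>ln (1 / \<rho>)\<close>; the bound \<open>exp (- z) / z + 1 / (2 * z)\<close> of the
  integrand produces the exponential integrals and the half logarithm.\<close>

lemma inner_matrix_columns:
  fixes A B :: "real ^ 'n ^ 'm"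
  shows "A \<bullet> B = (\<Sum>j\<in>UNIV. (A *v axis j 1) \<bullet> (B *v axis j 1))"
  unfolding matrix_vector_mult_basis column_def inner_vec_def by simp (rule sum.swap)

lemma norm_matrix_columns:
  fixes A :: "real ^ 'n ^ 'm"
  shows "(norm A)\<^sup>2 = (\<Sum>j\<in>UNIV. (norm (A *v axis j 1))\<^sup>2)"
  by (simp add: power2_norm_eq_inner inner_matrix_columns)

lemma inner_transpose:
  fixes A B :: "real ^ 'n ^ 'm"
  shows "transpose A \<bullet> transpose B = A \<bullet> B"
  unfolding inner_vec_def transpose_def by simp (rule sum.swap)

lemma norm_transpose:
  fixes A :: "real ^ 'n ^ 'm"
  shows "norm (transpose A) = norm A"
  unfolding norm_eq_sqrt_inner inner_transpose ..

lemma norm_matrix_vector_mult_le: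
  fixes A :: "real ^ 'n ^ 'm"
  shows "norm (A *v x) \<le> norm A * norm x"
proof -
  have "(norm (A *v x))\<^sup>2 = (\<Sum>i\<in>UNIV. (A $ i \<bullet> x)\<^sup>2)"
    unfolding power2_norm_eq_inner inner_vec_def[of "A *v x"]
    by (simp add: matrix_vector_mul_component power2_eq_square)
  also have "\<dots> \<le> (\<Sum>i\<in>UNIV. (norm (A $ i) * norm x)\<^sup>2)"
    by (intro sum_mono) (simp add: abs_le_square_iff[symmetric] Cauchy_Schwarz_ineq2)
  also have "\<dots> = (norm A * norm x)\<^sup>2"
    by (simp add: power_mult_distrib power2_norm_eq_inner inner_vec_def[of A A] sum_distrib_right)
  finally show ?thesis by (rule power2_le_imp_le) simp
qed

lemma norm_vector_matrix_mult_le: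
  fixes A :: "real ^ 'n ^ 'm"
  shows "norm (x v* A) \<le> norm A * norm x"
  using norm_matrix_vector_mult_le[of "transpose A" x] by (simp add: norm_transpose)

text \<open>Squaring and summing over the standard basis loses no dimension factor. This is how
  estimates for single vectors become Frobenius estimates.\<close>

lemma norm_matrix_le_pointwise:
  fixes A :: "real ^ 'n ^ 'm" and B :: "real ^ 'n ^ 'k"
  assumes "\<And>x. norm (A *v x) \<le> c * norm (B *v x)" "0 \<le> c"
  shows "norm A \<le> c * norm B"
proof -
  have "(norm A)\<^sup>2 \<le> (\<Sum>j\<in>UNIV. (c * norm (B *v axis j 1))\<^sup>2)"
    unfolding norm_matrix_columns by (intro sum_mono power_mono assms) simp
  also have "\<dots> = (c * norm B)\<^sup>2"
    by (simp add: power_mult_distrib norm_matrix_columns[of B] sum_distrib_left)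
  finally show ?thesis by (rule power2_le_imp_le) (use assms in simp)
qed

lemma matrix_vector_mult_minus_right: "(A :: real ^ 'n ^ 'm) *v (- x) = - (A *v x)"
  using matrix_vector_mult_diff_distrib[of A 0 x] by simp

lemma inner_matrix_mult_left:
  fixes A :: "real ^ 'n ^ 'm" and B :: "real ^ 'k ^ 'n"
  shows "(A ** B) \<bullet> C = B \<bullet> (transpose A ** C)"
  unfolding inner_matrix_columns
proof (intro sum.cong refl)
  fix j :: 'k
  have "((A ** B) *v axis j 1) \<bullet> (C *v axis j 1) = (C *v axis j 1) \<bullet> (A *v (B *v axis j 1))"
    by (simp add: inner_commute matrix_vector_mul_assoc)
  also have "\<dots> = ((transpose A ** C) *v axis j 1) \<bullet> (B *v axis j 1)"
    unfolding matrix_vector_mul_assoc[of "transpose A", symmetric] by (simp add: dot_lmul_matrix)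
  finally show "((A ** B) *v axis j 1) \<bullet> (C *v axis j 1)
      = (B *v axis j 1) \<bullet> ((transpose A ** C) *v axis j 1)"
    by (simp add: inner_commute)
qed

lemma inner_matrix_mult_right:
  fixes A :: "real ^ 'n ^ 'm" and B :: "real ^ 'k ^ 'n"
  shows "(A ** B) \<bullet> C = A \<bullet> (C ** transpose B)"
  using inner_matrix_mult_left[of "transpose B" "transpose A" "transpose C"]
  by (metis inner_transpose matrix_transpose_mul transpose_transpose)

section \<open>Orthogonal projections and the Pythagorean block decomposition\<close>

definition orth_proj :: "real ^ 'n ^ 'n \<Rightarrow> bool" where
  "orth_proj P \<longleftrightarrow> transpose P = P \<and> P ** P = P"

lemma orth_proj_vector_matrix: "orth_proj P \<Longrightarrow> x v* P = P *v x"
  unfolding orth_proj_def by (metis transpose_matrix_vector)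

lemma orth_proj_idem: "orth_proj P \<Longrightarrow> P *v (P *v x) = P *v x"
  by (simp add: orth_proj_def matrix_vector_mul_assoc)

lemma orth_proj_inner: "orth_proj P \<Longrightarrow> (P *v x) \<bullet> y = x \<bullet> (P *v y)"
  by (metis dot_lmul_matrix orth_proj_vector_matrix)

lemma matrix_diff_ldistrib: "(A :: real ^ 'n ^ 'm) ** (B - C) = A ** B - A ** C"
  by (simp add: matrix_eq matrix_vector_mul_assoc[symmetric] matrix_vector_mult_diff_rdistrib matrix_vector_mult_diff_distrib)

lemma matrix_diff_rdistrib: "(A - B :: real ^ 'n ^ 'm) ** C = A ** C - B ** C"
  by (simp add: matrix_eq matrix_vector_mul_assoc[symmetric] matrix_vector_mult_diff_rdistrib)

lemma orth_proj_compl: "orth_proj P \<Longrightarrow> orth_proj (mat 1 - P)"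
  unfolding orth_proj_def
  by (auto simp: matrix_diff_ldistrib matrix_diff_rdistrib) (simp add: transpose_def vec_eq_iff mat_def)

lemma orth_proj_pythagoras:
  assumes "orth_proj P"
  shows "(norm x)\<^sup>2 = (norm (P *v x))\<^sup>2 + (norm (x - P *v x))\<^sup>2"
proof -
  have "(P *v x) \<bullet> (P *v x) = (P *v x) \<bullet> x"
    by (metis assms inner_commute orth_proj_idem orth_proj_inner)
  then show ?thesis by (simp add: power2_norm_eq_inner inner_diff inner_commute)
qed

lemma orth_proj_pythagoras_left:
  assumes "orth_proj P"
  shows "(norm A)\<^sup>2 = (norm (P ** A))\<^sup>2 + (norm ((mat 1 - P) ** A))\<^sup>2"
  unfolding norm_matrix_columns[of A] norm_matrix_columns[of "P ** A"] norm_matrix_columns[of "_ ** A"]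
    sum.distrib[symmetric] matrix_vector_mul_assoc[symmetric] matrix_vector_mult_diff_rdistrib
    matrix_vector_mul_lid
  by (intro sum.cong refl orth_proj_pythagoras assms)

lemma orth_proj_pythagoras_right:
  assumes "orth_proj P"
  shows "(norm A)\<^sup>2 = (norm (A ** P))\<^sup>2 + (norm (A ** (mat 1 - P)))\<^sup>2"
  using orth_proj_pythagoras_left[OF assms, of "transpose A"]
    norm_transpose[of A] norm_transpose[of "A ** P"] norm_transpose[of "A ** (mat 1 - P)"]
    assms orth_proj_compl[OF assms]
  by (simp add: matrix_transpose_mul orth_proj_def)

lemma orth_proj_blocks:
  assumes P: "orth_proj P" and Q: "orth_proj Q"
  shows "(norm A)\<^sup>2 = (norm (P ** A ** Q))\<^sup>2 + (norm (P ** A ** (mat 1 - Q)))\<^sup>2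
    + (norm ((mat 1 - P) ** A ** Q))\<^sup>2 + (norm ((mat 1 - P) ** A ** (mat 1 - Q)))\<^sup>2"
  using orth_proj_pythagoras_left[OF P, of A] orth_proj_pythagoras_right[OF Q, of "P ** A"]
    orth_proj_pythagoras_right[OF Q, of "(mat 1 - P) ** A"] by simp

lemma norm_orth_proj_sandwich_le:
  assumes "orth_proj P" "orth_proj Q"
  shows "norm (P ** A ** Q) \<le> norm A"
  by (rule power2_le_imp_le) (use orth_proj_blocks[OF assms, of A] in simp_all)

text \<open>The index set is arbitrary because both the leading part \<open>{1..r}\<close> and the
  tail \<open>{Suc r..N}\<close> of one singular value decomposition occur later.\<close>

lemma orthonormal_norm_sum:
  assumes "orthonormal_upto N w" "I \<subseteq> {1..N}"
  shows "(norm (\<Sum>i\<in>I. c i *\<^sub>R w i))\<^sup>2 = (\<Sum>i\<in>I. (c i)\<^sup>2)"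
proof -
  have fin: "finite I" using assms(2) finite_subset by blast
  have "(norm (\<Sum>i\<in>I. c i *\<^sub>R w i))\<^sup>2 = (\<Sum>i\<in>I. \<Sum>j\<in>I. c i * (c j * (w j \<bullet> w i)))"
    by (simp add: power2_norm_eq_inner inner_sum_left inner_sum_right sum_distrib_left)
  also have "\<dots> = (\<Sum>i\<in>I. \<Sum>j\<in>I. if j = i then c i * c i else 0)"
    using assms by (intro sum.cong refl) (auto simp: orthonormal_upto_def subset_iff)
  also have "\<dots> = (\<Sum>i\<in>I. (c i)\<^sup>2)" using fin by (simp add: power2_eq_square)
  finally show ?thesis .
qed

lemma orthonormal_inner_sum:
  assumes "orthonormal_upto N w" "I \<subseteq> {1..N}" "j \<in> {1..N}"
  shows "w j \<bullet> (\<Sum>i\<in>I. c i *\<^sub>R w i) = (if j \<in> I then c j else 0)"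
proof -
  have fin: "finite I" using assms(2) finite_subset by blast
  have "w j \<bullet> (\<Sum>i\<in>I. c i *\<^sub>R w i) = (\<Sum>i\<in>I. if i = j then c j else 0)"
    unfolding inner_sum_right
    using assms by (intro sum.cong refl) (auto simp: orthonormal_upto_def subset_iff)
  then show ?thesis using fin by simp
qed

lemma orthonormal_residual:
  assumes "orthonormal_upto N w" "I \<subseteq> {1..N}"
  shows "(norm x)\<^sup>2 = (\<Sum>i\<in>I. (w i \<bullet> x)\<^sup>2) + (norm (x - (\<Sum>i\<in>I. (w i \<bullet> x) *\<^sub>R w i)))\<^sup>2"
proof -
  let ?s = "\<Sum>i\<in>I. (w i \<bullet> x) *\<^sub>R w i"
  have "(norm (x - ?s))\<^sup>2 = (norm x)\<^sup>2 - 2 * (x \<bullet> ?s) + (norm ?s)\<^sup>2"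
    by (simp add: power2_norm_eq_inner inner_diff inner_commute)
  moreover have "x \<bullet> ?s = (\<Sum>i\<in>I. (w i \<bullet> x)\<^sup>2)"
    by (simp add: inner_sum_right power2_eq_square inner_commute)
  ultimately show ?thesis using orthonormal_norm_sum[OF assms, of "\<lambda>i. w i \<bullet> x"] by simp
qed

lemma bessel:
  assumes "orthonormal_upto N w" "I \<subseteq> {1..N}"
  shows "(\<Sum>i\<in>I. (w i \<bullet> x)\<^sup>2) \<le> (norm x)\<^sup>2"
  using orthonormal_residual[OF assms, of x] by simp

section \<open>Sums of outer products with orthonormal factors\<close>

lemma outer_mult_vector: "outer x y *v z = (y \<bullet> z) *\<^sub>R x"
  by (simp add: outer_def matrix_vector_mult_def vec_eq_iff inner_vec_def sum_distrib_left sum_distrib_right mult_ac)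

lemma transpose_outer: "transpose (outer x y) = outer y x"
  by (simp add: outer_def transpose_def vec_eq_iff mult.commute)

lemma sum_matrix_vector_mult: "(\<Sum>i\<in>I. A i) *v (x :: real ^ 'n) = (\<Sum>i\<in>I. A i *v x)"
  by (induction I rule: infinite_finite_induct) (auto simp: matrix_vector_mult_add_rdistrib)

lemma transpose_diff:
  fixes A B :: "real ^ 'n ^ 'm"
  shows "transpose (A - B) = transpose A - transpose B"
  by (simp add: transpose_def vec_eq_iff)

lemma transpose_sum: "transpose (\<Sum>i\<in>I. A i) = (\<Sum>i\<in>I. transpose (A i))"
  by (induction I rule: infinite_finite_induct) (auto simp: transpose_def vec_eq_iff)

lemma sum_outer_mult_vector:
  "(\<Sum>i\<in>I. c i *\<^sub>R outer (u i) (v i)) *v x = (\<Sum>i\<in>I. (c i * (v i \<bullet> x)) *\<^sub>R u i)"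
  by (simp add: sum_matrix_vector_mult scaleR_matrix_vector_assoc[symmetric] outer_mult_vector)

lemma vector_mult_sum_outer:
  "x v* (\<Sum>i\<in>I. c i *\<^sub>R outer (u i) (v i)) = (\<Sum>i\<in>I. (c i * (u i \<bullet> x)) *\<^sub>R v i)"
proof -
  have "transpose (\<Sum>i\<in>I. c i *\<^sub>R outer (u i) (v i)) = (\<Sum>i\<in>I. c i *\<^sub>R outer (v i) (u i))"
    by (simp add: transpose_sum transpose_scalar transpose_outer)
  then show ?thesis
    unfolding transpose_matrix_vector[symmetric] by (simp only: sum_outer_mult_vector)
qed

lemma orth_complement_proj_mult:
  "orth_complement_proj r w *v x = x - (\<Sum>i = 1..r. (w i \<bullet> x) *\<^sub>R w i)"
  using sum_outer_mult_vector[of "\<lambda>_. 1" w w "{1..r}" x]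
  by (simp add: orth_complement_proj_def matrix_vector_mult_diff_rdistrib)

lemma orthonormal_upto_mono: "orthonormal_upto N w \<Longrightarrow> r \<le> N \<Longrightarrow> orthonormal_upto r w"
  by (auto simp: orthonormal_upto_def)

lemma inner_orth_complement_proj:
  assumes "orthonormal_upto r w" "i \<in> {1..r}"
  shows "w i \<bullet> (orth_complement_proj r w *v x) = 0"
  using orthonormal_inner_sum[OF assms(1) subset_refl assms(2)] assms(2)
  by (simp add: orth_complement_proj_mult inner_diff_right)

lemma orth_complement_proj_fixed:
  assumes "\<And>i. i \<in> {1..r} \<Longrightarrow> w i \<bullet> x = 0"
  shows "orth_complement_proj r w *v x = x"
  using assms by (simp add: orth_complement_proj_mult)

lemma orth_proj_orth_complement_proj:
  assumes "orthonormal_upto r w"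
  shows "orth_proj (orth_complement_proj r w)"
  unfolding orth_proj_def
proof
  show "transpose (orth_complement_proj r w) = orth_complement_proj r w"
    by (simp add: orth_complement_proj_def transpose_diff transpose_sum transpose_outer)
  show "orth_complement_proj r w ** orth_complement_proj r w = orth_complement_proj r w"
    unfolding matrix_eq matrix_vector_mul_assoc[symmetric]
    by (intro allI orth_complement_proj_fixed inner_orth_complement_proj[OF assms])
qed

lemma orth_complement_proj_basis:
  assumes "orthonormal_upto r w" "i \<in> {1..r}"
  shows "orth_complement_proj r w *v w i = 0"
proof -
  have "(\<Sum>j = 1..r. (w j \<bullet> w i) *\<^sub>R w j) = (\<Sum>j = 1..r. if j = i then w i else 0)"
    using assms by (intro sum.cong refl) (auto simp: orthonormal_upto_def)
  then show ?thesis using assms by (simp add: orth_complement_proj_mult)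
qed

lemma norm_sum_outer_mult:
  assumes "orthonormal_upto N u" "I \<subseteq> {1..N}"
  shows "(norm ((\<Sum>i\<in>I. s i *\<^sub>R outer (u i) (v i)) *v x))\<^sup>2 = (\<Sum>i\<in>I. (s i * (v i \<bullet> x))\<^sup>2)"
  unfolding sum_outer_mult_vector by (rule orthonormal_norm_sum[OF assms])

lemma norm_mult_sum_outer:
  assumes "orthonormal_upto N v" "I \<subseteq> {1..N}"
  shows "(norm (x v* (\<Sum>i\<in>I. s i *\<^sub>R outer (u i) (v i))))\<^sup>2 = (\<Sum>i\<in>I. (s i * (u i \<bullet> x))\<^sup>2)"
  unfolding vector_mult_sum_outer by (rule orthonormal_norm_sum[OF assms])

lemma inner_sum_outer_mult:
  "p \<bullet> ((\<Sum>i\<in>I. s i *\<^sub>R outer (u i) (v i)) *v q) = (\<Sum>i\<in>I. s i * (v i \<bullet> q) * (u i \<bullet> p))"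
  unfolding sum_outer_mult_vector by (simp add: inner_sum_right inner_commute)

text \<open>The hypothesis on \<open>x\<close> places it in the span of the \<open>v i\<close>,
  where Bessel's inequality is an equality; each coefficient is then stretched by at least
  \<open>c\<close>.\<close>

lemma norm_sum_outer_mult_ge:
  assumes u: "orthonormal_upto r u" and v: "orthonormal_upto r v"
    and s: "\<And>i. i \<in> {1..r} \<Longrightarrow> c \<le> s i" "0 \<le> c"
    and x: "orth_complement_proj r v *v x = 0"
  shows "c * norm x \<le> norm ((\<Sum>i = 1..r. s i *\<^sub>R outer (u i) (v i)) *v x)"
proof (rule power2_le_imp_le)
  have "(norm x)\<^sup>2 = (\<Sum>i = 1..r. (v i \<bullet> x)\<^sup>2)"
    using orthonormal_residual[OF v subset_refl, of x] x by (simp add: orth_complement_proj_mult)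
  then have "(c * norm x)\<^sup>2 = (\<Sum>i = 1..r. c\<^sup>2 * (v i \<bullet> x)\<^sup>2)"
    by (simp add: power_mult_distrib sum_distrib_left)
  also have "\<dots> \<le> (\<Sum>i = 1..r. (s i)\<^sup>2 * (v i \<bullet> x)\<^sup>2)"
    using s by (intro sum_mono mult_right_mono power_mono) auto
  also have "\<dots> = (norm ((\<Sum>i = 1..r. s i *\<^sub>R outer (u i) (v i)) *v x))\<^sup>2"
    unfolding norm_sum_outer_mult[OF u subset_refl] by (simp add: power_mult_distrib)
  finally show "(c * norm x)\<^sup>2 \<le> (norm ((\<Sum>i = 1..r. s i *\<^sub>R outer (u i) (v i)) *v x))\<^sup>2" .
qed simp

lemma norm_sum_outer_mult_le:
  assumes u: "orthonormal_upto N u" and v: "orthonormal_upto N v" and I: "I \<subseteq> {1..N}"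
    and s: "\<And>i. i \<in> I \<Longrightarrow> 0 \<le> s i \<and> s i \<le> c" "0 \<le> c"
  shows "norm ((\<Sum>i\<in>I. s i *\<^sub>R outer (u i) (v i)) *v x) \<le> c * norm x"
proof (rule power2_le_imp_le)
  have "(norm ((\<Sum>i\<in>I. s i *\<^sub>R outer (u i) (v i)) *v x))\<^sup>2 = (\<Sum>i\<in>I. (s i)\<^sup>2 * (v i \<bullet> x)\<^sup>2)"
    unfolding norm_sum_outer_mult[OF u I] by (simp add: power_mult_distrib)
  also have "\<dots> \<le> (\<Sum>i\<in>I. c\<^sup>2 * (v i \<bullet> x)\<^sup>2)"
    using s by (intro sum_mono mult_right_mono power_mono) auto
  also have "\<dots> \<le> (c * norm x)\<^sup>2"
    using bessel[OF v I, of x] by (simp add: sum_distrib_left[symmetric] power_mult_distrib mult_left_mono)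
  finally show "(norm ((\<Sum>i\<in>I. s i *\<^sub>R outer (u i) (v i)) *v x))\<^sup>2 \<le> (c * norm x)\<^sup>2" .
qed (use s in simp)

text \<open>In effect this is \<open>A = A A^+ A\<close> with a pseudo-inverse \<open>A^+\<close> of
  norm at most \<open>1 / c\<close>. It replaces inverting \<open>A\<close>: Cauchy-Schwarz splits
  the terms so that one factor carries all singular values, and the spare \<open>c\<close> restores
  them in the other. Applied to \<open>M\<close>, it makes the corner quadratically small.\<close>

lemma inner_sum_outer_mult_le:
  assumes u: "orthonormal_upto r u" and v: "orthonormal_upto r v"
    and s: "\<And>i. i \<in> {1..r} \<Longrightarrow> c \<le> s i" "0 \<le> c"
  defines "A \<equiv> \<Sum>i = 1..r. s i *\<^sub>R outer (u i) (v i)"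
  shows "c * \<bar>p \<bullet> (A *v q)\<bar> \<le> norm (p v* A) * norm (A *v q)"
proof -
  have "(p \<bullet> (A *v q))\<^sup>2 = (\<Sum>i = 1..r. (s i * (v i \<bullet> q)) * (u i \<bullet> p))\<^sup>2"
    by (simp add: A_def inner_sum_outer_mult)
  also have "\<dots> \<le> (\<Sum>i = 1..r. (s i * (v i \<bullet> q))\<^sup>2) * (\<Sum>i = 1..r. (u i \<bullet> p)\<^sup>2)"
    by (rule Cauchy_Schwarz_ineq_sum)
  also have "\<dots> = (norm (A *v q))\<^sup>2 * (\<Sum>i = 1..r. (u i \<bullet> p)\<^sup>2)"
    unfolding A_def norm_sum_outer_mult[OF u subset_refl] ..
  finally have 1: "(p \<bullet> (A *v q))\<^sup>2 \<le> (norm (A *v q))\<^sup>2 * (\<Sum>i = 1..r. (u i \<bullet> p)\<^sup>2)" .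
  have "c\<^sup>2 * (\<Sum>i = 1..r. (u i \<bullet> p)\<^sup>2) \<le> (\<Sum>i = 1..r. (s i * (u i \<bullet> p))\<^sup>2)"
    unfolding sum_distrib_left power_mult_distrib
    using s by (intro sum_mono mult_right_mono power_mono) auto
  also have "\<dots> = (norm (p v* A))\<^sup>2"
    unfolding A_def norm_mult_sum_outer[OF v subset_refl] ..
  finally have 2: "c\<^sup>2 * (\<Sum>i = 1..r. (u i \<bullet> p)\<^sup>2) \<le> (norm (p v* A))\<^sup>2" .
  have "(c * \<bar>p \<bullet> (A *v q)\<bar>)\<^sup>2 \<le> c\<^sup>2 * ((norm (A *v q))\<^sup>2 * (\<Sum>i = 1..r. (u i \<bullet> p)\<^sup>2))"
    using 1 by (simp add: power_mult_distrib mult_left_mono)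
  also have "\<dots> = (norm (A *v q))\<^sup>2 * (c\<^sup>2 * (\<Sum>i = 1..r. (u i \<bullet> p)\<^sup>2))" by simp
  also have "\<dots> \<le> (norm (A *v q))\<^sup>2 * (norm (p v* A))\<^sup>2" by (rule mult_left_mono[OF 2]) simp
  also have "\<dots> = (norm (p v* A) * norm (A *v q))\<^sup>2" by (simp add: power_mult_distrib)
  finally show ?thesis by (rule power2_le_imp_le) simp
qed

section \<open>Rank deficiency, kernel vectors and Schur complements\<close>

lemma rank_sum_outer_le:
  "rank (\<Sum>i = 1..r. s i *\<^sub>R outer (u i) (v i) :: real ^ 'n ^ 'm) \<le> r"
proof -
  let ?A = "\<Sum>i = 1..r. s i *\<^sub>R outer (u i) (v i) :: real ^ 'n ^ 'm"
  have "range ((*v) ?A) \<subseteq> span (u ` {1..r})"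
    unfolding sum_outer_mult_vector by (intro image_subsetI span_sum span_scale span_base) auto
  then have "rank ?A \<le> card (u ` {1..r})"
    unfolding rank_dim_range by (intro dim_le_card) auto
  also have "\<dots> \<le> r" using card_image_le[of "{1..r}" u] by simp
  finally show ?thesis .
qed

text \<open>The span of \<open>v 1, ..., v r\<close> and \<open>q\<close> has dimension
  \<open>r + 1\<close>, so \<open>A\<close> cannot be injective on it. The lemma is used in both
  directions: for the truncation \<open>Y\<close> over the singular space of \<open>M\<close>, and
  for \<open>M\<close> over that of \<open>Y\<close>.\<close>

lemma null_vector:
  fixes A :: "real ^ 'n ^ 'm"
  assumes rank: "rank A \<le> r" and v: "orthonormal_upto r v"
    and q: "q \<noteq> 0" "orth_complement_proj r v *v q = q"
  obtains f g where "orth_complement_proj r v *v f = 0" "f \<noteq> 0 \<or> g \<noteq> 0" "A *v (f + g *\<^sub>R q) = 0"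
proof -
  let ?S = "v ` {1..r}"
  have vq: "v i \<bullet> q = 0" if "i \<in> {1..r}" for i
    using inner_orth_complement_proj[OF v that, of q] q by simp
  have vv: "v i \<bullet> v j = (if i = j then 1 else 0)" if "i \<in> {1..r}" "j \<in> {1..r}" for i j
    using v that by (auto simp: orthonormal_upto_def)
  have inj: "inj_on v {1..r}"
    by (rule inj_onI) (metis vv zero_neq_one)
  have notin: "q \<notin> ?S" using vq q by (metis imageE inner_eq_zero_iff)
  have "0 \<notin> insert q ?S" using q vv by (auto simp: image_iff) (metis inner_zero_left vv zero_neq_one atLeastAtMost_iff One_nat_def)
  moreover have "pairwise orthogonal (insert q ?S)"
    unfolding pairwise_def orthogonal_def using vq vv by (auto simp: inner_commute)
  ultimately have ind: "independent (insert q ?S)"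
    by (rule pairwise_orthogonal_independent[rotated])
  have "dim (insert q ?S) = Suc r"
    using dim_eq_card_independent[OF ind] notin inj by (simp add: card_image)
  then have ninj: "\<not> inj_on ((*v) A) (span (insert q ?S))"
  proof -
    have "dim (((*v) A) ` insert q ?S) \<le> rank A"
      unfolding rank_dim_range by (rule dim_subset) auto
    then show ?thesis
      using dim_image_eq[of "(*v) A" "insert q ?S"] rank \<open>dim (insert q ?S) = Suc r\<close> by fastforce
  qed
  then obtain h where h: "h \<in> span (insert q ?S)" "A *v h = 0" "h \<noteq> 0"
    by (auto simp: linear_inj_on_iff_eq_0[OF matrix_vector_mul_linear subspace_span])
  from h(1) obtain g where g: "h - g *\<^sub>R q \<in> span ?S" by (auto simp: span_breakdown_eq)
  have "subspace {x. orth_complement_proj r v *v x = 0}"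
    by (auto simp: subspace_def matrix_vector_right_distrib matrix_vector_mult_scaleR)
  then have "span ?S \<subseteq> {x. orth_complement_proj r v *v x = 0}"
    by (intro span_minimal) (auto intro!: orth_complement_proj_basis[OF v])
  with g have "orth_complement_proj r v *v (h - g *\<^sub>R q) = 0" by auto
  moreover have "h - g *\<^sub>R q \<noteq> 0 \<or> g \<noteq> 0" using h(3) by auto
  moreover have "A *v ((h - g *\<^sub>R q) + g *\<^sub>R q) = 0" using h by simp
  ultimately show thesis by (rule that)
qed

lemma svd_top:
  assumes "is_svd N A s u v" "1 \<le> N"
  shows "norm (A *v x) \<le> s 1 * norm x" "norm (y v* A) \<le> s 1 * norm y"
    "A *v v 1 = s 1 *\<^sub>R u 1" "u 1 v* A = s 1 *\<^sub>R v 1" "norm (u 1) = 1" "norm (v 1) = 1" "0 \<le> s 1"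
proof -
  have u: "orthonormal_upto N u" and v: "orthonormal_upto N v"
    and A: "A = (\<Sum>i = 1..N. s i *\<^sub>R outer (u i) (v i))"
    and s: "\<And>i. i \<in> {1..N} \<Longrightarrow> 0 \<le> s i \<and> s i \<le> s 1" "0 \<le> s 1"
    using assms by (auto simp: is_svd_def)
  show "norm (A *v x) \<le> s 1 * norm x"
    unfolding A by (rule norm_sum_outer_mult_le[OF u v subset_refl s])
  have At: "transpose A = (\<Sum>i = 1..N. s i *\<^sub>R outer (v i) (u i))"
    unfolding A by (simp add: transpose_sum transpose_scalar transpose_outer)
  have "norm (transpose A *v y) \<le> s 1 * norm y"
    unfolding At by (rule norm_sum_outer_mult_le[OF v u subset_refl s])
  then show "norm (y v* A) \<le> s 1 * norm y" by simp
  have one: "1 \<in> {1..N}" using assms by simp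
  have "(\<Sum>i = 1..N. (s i * (v i \<bullet> v 1)) *\<^sub>R u i) = (\<Sum>i = 1..N. if i = 1 then s 1 *\<^sub>R u 1 else 0)"
    using v one by (intro sum.cong refl) (auto simp: orthonormal_upto_def)
  then show "A *v v 1 = s 1 *\<^sub>R u 1" using assms unfolding A sum_outer_mult_vector by simp
  have "(\<Sum>i = 1..N. (s i * (u i \<bullet> u 1)) *\<^sub>R v i) = (\<Sum>i = 1..N. if i = 1 then s 1 *\<^sub>R v 1 else 0)"
    using u one by (intro sum.cong refl) (auto simp: orthonormal_upto_def)
  then show "u 1 v* A = s 1 *\<^sub>R v 1" using assms unfolding A vector_mult_sum_outer by simp
  show "norm (u 1) = 1" "norm (v 1) = 1" using u v one by (auto simp: orthonormal_upto_def norm_eq_1)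
qed (use assms in \<open>simp add: is_svd_def\<close>)

text \<open>For a matrix of rank at most \<open>r\<close> with invertible upper left block, the
  lower right block is \<open>Y21 Y11^(-1) Y12\<close>. Since \<open>M\<close> occupies only the
  upper left block, the other blocks of \<open>Y\<close> are those of \<open>Z\<close>, and
  \<open>Y11\<close> has smallest singular value at least
  \<open>c - norm (L ** Z ** K)\<close>.\<close>

lemma schur_complement_bound:
  fixes M Y :: "real ^ 'n ^ 'm"
  assumes u: "orthonormal_upto r u" and v: "orthonormal_upto r v"
    and s: "\<And>i. i \<in> {1..r} \<Longrightarrow> c \<le> s i" "0 \<le> c"
    and M: "M = (\<Sum>i = 1..r. s i *\<^sub>R outer (u i) (v i))"
    and rank: "rank Y \<le> r"
  defines "G \<equiv> orth_complement_proj r u" and "F \<equiv> orth_complement_proj r v"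
  defines "L \<equiv> mat 1 - G" and "K \<equiv> mat 1 - F"
  defines "Z \<equiv> Y - M"
  assumes small: "norm (L ** Z ** K) < c"
  shows "(c - norm (L ** Z ** K)) * norm (G ** Y ** F) \<le> norm (G ** Z ** K) * norm (L ** Z ** F)"
proof -
  let ?a = "norm (L ** Z ** K)" and ?c = "norm (G ** Z ** K)"
  have Gp: "orth_proj G" and Fp: "orth_proj F"
    using u v by (auto simp: G_def F_def orth_proj_orth_complement_proj)
  have GM: "G *v (M *v x) = 0" for x
  proof -
    have "G *v (M *v x) = (\<Sum>i = 1..r. (s i * (v i \<bullet> x)) *\<^sub>R (G *v u i))"
      unfolding M sum_outer_mult_vector by (simp add: linear_sum[OF matrix_vector_mul_linear] matrix_vector_mult_scaleR)
    also have "\<dots> = 0" unfolding G_def by (simp add: orth_complement_proj_basis[OF u])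
    finally show ?thesis .
  qed
  have MF: "M *v q = 0" if "F *v q = q" for q
    unfolding M sum_outer_mult_vector
    using inner_orth_complement_proj[OF v, of _ q] that by (intro sum.neutral) (auto simp: F_def)
  have "norm ((G ** Y ** F) *v x) \<le> ?c / (c - ?a) * norm ((L ** Z ** F) *v x)" for x
  proof -
    define q where "q = F *v x"
    have Fq: "F *v q = q" using orth_proj_idem[OF Fp] by (simp add: q_def)
    show ?thesis
    proof (cases "q = 0")
      case True
      then show ?thesis using small by (simp add: q_def matrix_vector_mul_assoc[symmetric])
    next
      case False
      \<comment> \<open>The kernel vector avoids the inverse block: its upper component says
        \<open>f = - g Y11^(-1) Y12 q\<close>, and its lower component recovers \<open>Y22 q\<close>
        from \<open>f\<close>.\<close>
      obtain f g where f: "F *v f = 0" "f \<noteq> 0 \<or> g \<noteq> 0" "Y *v (f + g *\<^sub>R q) = 0"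
        using null_vector[OF rank v False] Fq unfolding F_def by metis
      have Kf: "K *v f = f" using f by (simp add: K_def matrix_vector_mult_diff_rdistrib)
      have Yf: "Y *v f = - g *\<^sub>R (Y *v q)"
        using f(3) by (simp add: matrix_vector_right_distrib matrix_vector_mult_scaleR eq_neg_iff_add_eq_0)
      have "M *v f = L *v (M *v f)" using GM by (simp add: L_def matrix_vector_mult_diff_rdistrib)
      also have "\<dots> = L *v (- g *\<^sub>R (Z *v q) - Z *v f)"
        using Yf MF[OF Fq] by (simp add: Z_def matrix_vector_mult_diff_rdistrib)
      also have "\<dots> = - g *\<^sub>R ((L ** Z ** F) *v q) - (L ** Z ** K) *v f"
        using Kf Fq by (simp add: matrix_vector_mul_assoc[symmetric] matrix_vector_mult_diff_distrib
            matrix_vector_mult_scaleR matrix_vector_mult_minus_right)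
      finally have "norm (M *v f) \<le> \<bar>g\<bar> * norm ((L ** Z ** F) *v q) + norm ((L ** Z ** K) *v f)"
        using norm_triangle_ineq4[of "- g *\<^sub>R ((L ** Z ** F) *v q)" "(L ** Z ** K) *v f"] by simp
      also have "\<dots> \<le> \<bar>g\<bar> * norm ((L ** Z ** F) *v q) + ?a * norm f"
        by (intro add_left_mono norm_matrix_vector_mult_le)
      finally have "norm (M *v f) \<le> \<bar>g\<bar> * norm ((L ** Z ** F) *v q) + ?a * norm f" .
      moreover have "c * norm f \<le> norm (M *v f)"
        unfolding M by (rule norm_sum_outer_mult_ge[OF u v s]) (use f in \<open>simp_all add: F_def\<close>)
      ultimately have "c * norm f \<le> \<bar>g\<bar> * norm ((L ** Z ** F) *v q) + ?a * norm f" by simp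
      then have fb: "(c - ?a) * norm f \<le> \<bar>g\<bar> * norm ((L ** Z ** F) *v q)" by (simp add: algebra_simps)
      \<comment> \<open>Otherwise \<open>f\<close> would be a nonzero kernel vector of the upper
        left block.\<close>
      have g: "g \<noteq> 0"
      proof
        assume "g = 0"
        then have "(c - ?a) * norm f \<le> 0" using fb by simp
        then have "f = 0" using small by (simp add: mult_le_0_iff)
        then show False using f(2) \<open>g = 0\<close> by simp
      qed
      have "g *\<^sub>R (G *v (Y *v q)) = - (G *v (Y *v f))"
        using Yf by (simp add: matrix_vector_mult_scaleR matrix_vector_mult_minus_right)
      also have "G *v (Y *v f) = (G ** Z ** K) *v f"
        using Kf GM by (simp add: Z_def matrix_vector_mul_assoc[symmetric] matrix_vector_mult_diff_rdistrib matrix_vector_mult_diff_distrib)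
      finally have "\<bar>g\<bar> * norm (G *v (Y *v q)) = norm ((G ** Z ** K) *v f)"
        by (metis norm_minus_cancel norm_scaleR)
      also have "\<dots> \<le> ?c * norm f" by (rule norm_matrix_vector_mult_le)
      finally have "(c - ?a) * (\<bar>g\<bar> * norm (G *v (Y *v q))) \<le> (c - ?a) * (?c * norm f)"
        using small by (intro mult_left_mono) auto
      also have "\<dots> = ?c * ((c - ?a) * norm f)" by simp
      also have "\<dots> \<le> ?c * (\<bar>g\<bar> * norm ((L ** Z ** F) *v q))" using fb by (intro mult_left_mono) auto
      finally have "\<bar>g\<bar> * ((c - ?a) * norm (G *v (Y *v q))) \<le> \<bar>g\<bar> * (?c * norm ((L ** Z ** F) *v q))"
        by (simp add: mult_ac)
      then have "(c - ?a) * norm (G *v (Y *v q)) \<le> ?c * norm ((L ** Z ** F) *v q)" using g by simp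
      moreover have "(L ** Z ** F) *v q = (L ** Z ** F) *v x" "G *v (Y *v q) = (G ** Y ** F) *v x"
        using Fq by (simp_all add: matrix_vector_mul_assoc[symmetric] q_def)
      ultimately show ?thesis using small by (simp add: field_simps)
    qed
  qed
  then have "norm (G ** Y ** F) \<le> ?c / (c - ?a) * norm (L ** Z ** F)"
    using small by (intro norm_matrix_le_pointwise) auto
  then show ?thesis using small by (simp add: field_simps)
qed

section \<open>Perturbation of the truncated singular value decomposition\<close>

text \<open>
  The numeric lemmas are scaled so that the \<open>r\<close>-th singular value of \<open>M\<close> is \<open>1\<close>. In the first one, \<open>A\<close>,
  \<open>B\<close>, \<open>C\<close>, \<open>w\<close> are the norms of the blocks of \<open>X - M\<close>, and \<open>d\<close> is the largest singular value of the
  lower right block of \<open>Y - M\<close>.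
\<close>
lemma top_corner_numeric:
  fixes c :: real
  assumes c: "1 + 1 / sqrt 2 \<le> c" and t: "0 \<le> t" "t * c < 1"
    and nn: "0 \<le> A" "0 \<le> B" "0 \<le> C" "0 \<le> d" "0 \<le> w"
    and le: "A\<^sup>2 + B\<^sup>2 + C\<^sup>2 + w\<^sup>2 \<le> t\<^sup>2"
    and quad: "d \<le> (B\<^sup>2 + C\<^sup>2) / 2 + d\<^sup>2"
    and gap: "d > 0 \<Longrightarrow> d - B * C / d \<le> A + w"
  shows "d \<le> c * (B\<^sup>2 + C\<^sup>2) / 2" "(B\<^sup>2 + C\<^sup>2) / 2 + d\<^sup>2 \<le> c * (B\<^sup>2 + C\<^sup>2) / 2"
proof -
  define m where "m = B\<^sup>2 + C\<^sup>2"
  have m: "0 \<le> m" "m \<le> t\<^sup>2"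
    unfolding m_def using le zero_le_power2[of A] zero_le_power2[of w] by (simp, linarith)
  have s2: "sqrt 2 * sqrt 2 = 2" "0 < sqrt 2" by auto
  have "sqrt 2 * (1 + 1 / sqrt 2) \<le> sqrt 2 * c" using c by (intro mult_left_mono) auto
  then have c': "sqrt 2 + 1 \<le> sqrt 2 * c" by (simp add: distrib_left)
  have c1: "1 < c" using c by (smt (verit) divide_pos_pos real_sqrt_gt_0_iff)
  \<comment> \<open>With the lower bound on \<open>c\<close> this yields
    \<open>t < 2 - sqrt 2 < 1 / sqrt 2\<close>, which excludes the large root of the quadratic
    inequality below.\<close>
  have "sqrt 2 * (t * c) < sqrt 2 * 1" using t s2 by (intro mult_strict_left_mono)
  then have "t * (sqrt 2 * c) < sqrt 2" by (simp add: mult_ac)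
  moreover have "t * (sqrt 2 + 1) \<le> t * (sqrt 2 * c)" using c' t by (intro mult_left_mono) auto
  ultimately have "t * sqrt 2 + t < sqrt 2" unfolding distrib_left by linarith
  have d2: "d\<^sup>2 \<le> m / 2"
  proof (rule ccontr)
    assume "\<not> d\<^sup>2 \<le> m / 2"
    then have big: "m / 2 < d\<^sup>2" by simp
    then have d: "0 < d" using m nn by (metis div_0 less_eq_real_def not_less power_zero_numeral half_gt_zero_iff le_less_trans zero_less_power2)
    \<comment> \<open>The partner of \<open>d\<close> with product \<open>m / 2\<close>. Adding
      \<open>4 * n * d = 2 * m\<close> to the bound on \<open>(d - n)^2\<close> cancels
      \<open>m\<close> and leaves \<open>(d + n)^2 \<le> 2 * t^2\<close>, whereas
      \<open>quad\<close> divided by \<open>d\<close> reads \<open>1 \<le> d + n\<close>.\<close>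
    define n where "n = m / (2 * d)"
    have nd: "n * d = m / 2" using d by (simp add: n_def)
    have n: "0 \<le> n" "n \<le> d"
    proof -
      show "0 \<le> n" using m d by (simp add: n_def)
      have "n * d \<le> d * d" using big nd by (simp add: power2_eq_square)
      then show "n \<le> d" using d by simp
    qed
    have "B * C \<le> m / 2" using sum_squares_bound[of B C] by (simp add: m_def)
    then have "B * C / d \<le> n" using d by (simp add: n_def field_simps)
    then have "d - n \<le> A + w" using gap d by simp
    then have "(d - n)\<^sup>2 \<le> (A + w)\<^sup>2" using n by (intro power_mono) auto
    also have "\<dots> \<le> 2 * (A\<^sup>2 + w\<^sup>2)" using sum_squares_bound[of A w] by (simp add: power2_sum)
    also have "\<dots> \<le> 2 * (t\<^sup>2 - m)" using le by (simp add: m_def)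
    finally have "(d + n)\<^sup>2 \<le> 2 * t\<^sup>2"
      using nd by (simp add: power2_sum power2_diff mult_ac)
    moreover have "1 \<le> d + n"
    proof -
      have "d * 1 \<le> d * (d + n)" using quad nd unfolding m_def power2_eq_square distrib_left mult.commute[of n] by linarith
      then show ?thesis using d by simp
    qed
    then have "1 \<le> (d + n)\<^sup>2" by simp
    ultimately have "1 \<le> 2 * t\<^sup>2" by simp
    then have "1 \<le> (t * sqrt 2)\<^sup>2" by (simp add: power_mult_distrib)
    then have "1 \<le> t * sqrt 2" using t by (smt (verit) power2_le_imp_le mult_nonneg_nonneg s2 one_power2)
    then have "sqrt 2 \<le> t * sqrt 2 * sqrt 2" by simp
    then have "sqrt 2 \<le> 2 * t" using s2 by (simp add: mult.assoc)
    then show False using \<open>t * sqrt 2 + t < sqrt 2\<close> \<open>1 \<le> t * sqrt 2\<close> sqrt2_less_2 by linarith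
  qed
  \<comment> \<open>The constant \<open>1 + 1 / sqrt 2\<close> enters here:
    \<open>d \<le> t / sqrt 2 \<le> 1 / (sqrt 2 * c) \<le> 1 - 1 / c\<close>, so the factor
    \<open>1 - d\<close> in \<open>d * (1 - d) \<le> m / 2\<close> is at least
    \<open>1 / c\<close>.\<close>
  have "(sqrt 2 * d)\<^sup>2 \<le> t\<^sup>2" using d2 m by (simp add: power_mult_distrib)
  then have dt: "sqrt 2 * d \<le> t" using t(1) by (rule power2_le_imp_le)
  have "sqrt 2 * (c * d) \<le> t * c" using mult_right_mono[OF dt, of c] c1 by (simp add: mult_ac)
  then have "sqrt 2 * (c * d) \<le> 1" using t by simp
  then have "sqrt 2 * (c * d) \<le> sqrt 2 * (c - 1)" using c' by (simp add: right_diff_distrib)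
  then have cd: "c * d \<le> c - 1" using s2 by simp
  have "c * (d * (1 - d)) \<le> c * (m / 2)"
  proof (rule mult_left_mono)
    show "d * (1 - d) \<le> m / 2" using quad unfolding m_def power2_eq_square right_diff_distrib by linarith
  qed (use c1 in simp)
  then have "c * d \<le> c * m / 2 + d * (c * d)" by (simp add: algebra_simps)
  also have "d * (c * d) \<le> d * (c - 1)" using cd nn by (intro mult_left_mono)
  finally have dk: "d \<le> c * m / 2" by (simp add: algebra_simps)
  then show "d \<le> c * (B\<^sup>2 + C\<^sup>2) / 2" by (simp add: m_def)
  have "c * d\<^sup>2 \<le> (c - 1) * (c * m / 2)"
    using mult_mono[OF cd dk] nn c1 by (simp add: power2_eq_square mult_ac)
  then have "c * d\<^sup>2 \<le> c * ((c - 1) * m / 2)" by (simp add: mult_ac)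
  then have "d\<^sup>2 \<le> (c - 1) * m / 2" using c1 by simp
  then have "m / 2 + d\<^sup>2 \<le> c * m / 2" by (simp add: left_diff_distrib diff_divide_distrib)
  then show "(B\<^sup>2 + C\<^sup>2) / 2 + d\<^sup>2 \<le> c * (B\<^sup>2 + C\<^sup>2) / 2" by (simp add: m_def)
qed

text \<open>The quantity is at most \<open>1 / (2 * c)\<close>, and \<open>3 / 2 \<le> c\<close>
  gives \<open>1 / (2 * c) \<le> 1 / 3 \<le> 1 - 1 / c\<close>.\<close>

lemma small_radius_numeric:
  fixes c t :: real
  assumes c: "3 / 2 \<le> c" and t: "0 \<le> t" "t * c < 1"
  shows "c * t\<^sup>2 / 2 \<le> 1 - 1 / c" "c * t\<^sup>2 / 2 \<le> 1 / 3"
proof -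
  have "c * t\<^sup>2 * c \<le> 1" using power_mono[of "t * c" 1 2] t c by (simp add: power2_eq_square mult_ac)
  then have k: "c * t\<^sup>2 \<le> 1 / c" using c by (simp add: field_simps)
  have "1 / c \<le> 2 / 3" using c by (simp add: field_simps)
  then show "c * t\<^sup>2 / 2 \<le> 1 - 1 / c" "c * t\<^sup>2 / 2 \<le> 1 / 3" using k by linarith+
qed

text \<open>Passes from the largest singular value \<open>e\<close> of the corner to its Frobenius
  norm \<open>d\<close>. The arithmetic-geometric mean turns \<open>D\<close> into
  \<open>2 * d - d^2 \<le> m + e^2\<close>, and the right side is at most \<open>2 * k - k^2\<close>
  for \<open>k = c * m / 2\<close>. As \<open>2 * x - x^2\<close> increases up to
  \<open>x = 1\<close>, the claim follows once \<open>d \<le> 1\<close> is known.\<close>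

lemma corner_numeric:
  fixes c :: real
  assumes c: "3 / 2 \<le> c" and t: "0 \<le> t" "t * c < 1"
    and m: "B\<^sup>2 + C\<^sup>2 \<le> t\<^sup>2" and d: "0 \<le> d" "0 \<le> e"
    and e: "e \<le> c * (B\<^sup>2 + C\<^sup>2) / 2"
    and D: "d\<^sup>2 \<le> (C\<^sup>2 + e\<^sup>2) * (B\<^sup>2 + d\<^sup>2)"
  shows "d \<le> c * t\<^sup>2 / 2"
proof -
  define m where "m = B\<^sup>2 + C\<^sup>2"
  define k where "k = c * m / 2"
  have m0: "0 \<le> m" "m \<le> t\<^sup>2" using assms by (auto simp: m_def)
  have kt: "k \<le> c * t\<^sup>2 / 2" using m0 c by (simp add: k_def mult_left_mono)
  have "0 \<le> k" using m0 c by (simp add: k_def)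
  then have k: "0 \<le> k" "k \<le> 1 - 1 / c" "k \<le> 1 / 3" using small_radius_numeric[OF c t] kt by linarith+
  have ek: "e \<le> k" using e by (simp add: k_def m_def)
  have e2: "e\<^sup>2 \<le> k\<^sup>2" using ek d by (intro power_mono)
  have mk: "m = 2 * k / c" using c by (simp add: k_def)
  \<comment> \<open>Since \<open>m = 2 * k / c\<close>, the bound \<open>k \<le> 1 - 1 / c\<close>
    says exactly that \<open>m + 2 * k^2 \<le> 2 * k\<close>.\<close>
  have S: "m + e\<^sup>2 \<le> 2 * k - k\<^sup>2"
  proof -
    have "k * k \<le> k * (1 - 1 / c)" using k by (intro mult_left_mono) auto
    then have "k\<^sup>2 + m / 2 \<le> k" by (simp add: mk power2_eq_square right_diff_distrib)
    then have "2 * k\<^sup>2 + m \<le> 2 * k" by simp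
    then show ?thesis using e2 by simp
  qed
  have "k\<^sup>2 \<ge> 0" by simp
  have S1: "C\<^sup>2 + e\<^sup>2 \<le> 2 / 3 - B\<^sup>2"
    using S k(3) \<open>k\<^sup>2 \<ge> 0\<close> unfolding m_def by linarith
  have d1: "d \<le> 1"
  proof (rule ccontr)
    assume "\<not> d \<le> 1"
    then have "1 < d\<^sup>2" by (simp add: one_less_power)
    have "d\<^sup>2 \<le> (2 / 3 - B\<^sup>2) * (B\<^sup>2 + d\<^sup>2)" using D S1 by (meson add_nonneg_nonneg mult_right_mono order_trans zero_le_power2)
    also have "\<dots> = 2 / 3 * d\<^sup>2 + B\<^sup>2 * (2 / 3 - B\<^sup>2 - d\<^sup>2)" by (simp add: algebra_simps power2_eq_square)
    also have "\<dots> \<le> 2 / 3 * d\<^sup>2"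
    proof -
      have "2 / 3 - B\<^sup>2 - d\<^sup>2 \<le> 0" using \<open>1 < d\<^sup>2\<close> zero_le_power2[of B] by linarith
      then have "B\<^sup>2 * (2 / 3 - B\<^sup>2 - d\<^sup>2) \<le> 0" by (intro mult_nonneg_nonpos) auto
      then show ?thesis by simp
    qed
    finally show False using \<open>1 < d\<^sup>2\<close> by simp
  qed
  have "d\<^sup>2 \<le> (((C\<^sup>2 + e\<^sup>2) + (B\<^sup>2 + d\<^sup>2)) / 2)\<^sup>2"
  proof -
    have "(x * y) \<le> ((x + y) / 2)\<^sup>2" for x y :: real
      using zero_le_power2[of "x - y"] by (simp add: power2_eq_square field_simps)
    then show ?thesis using D order_trans by blast
  qed
  then have "d \<le> ((C\<^sup>2 + e\<^sup>2) + (B\<^sup>2 + d\<^sup>2)) / 2"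
    by (rule power2_le_imp_le) (simp add: add_nonneg_nonneg)
  then have q: "2 * d - d\<^sup>2 \<le> m + e\<^sup>2" by (simp add: m_def)
  have "d \<le> k"
  proof (rule ccontr)
    assume "\<not> d \<le> k"
    then have "0 < (d - k) * (2 - d - k)" using d1 k by (intro mult_pos_pos) auto
    then have "2 * k - k\<^sup>2 < 2 * d - d\<^sup>2" by (simp add: power2_eq_square algebra_simps)
    then show False using q S by simp
  qed
  then show ?thesis using kt by simp
qed

text \<open>If \<open>d\<close> exceeded \<open>k = c * t^2 / 2\<close>, the sum of squares would
  leave \<open>B^2 + C^2 < t^2 - A^2\<close>, while \<open>D\<close> demands at least
  \<open>2 * (1 - A) * k\<close>. Completing the square in \<open>A\<close> gives
  \<open>2 * k < t^2 + k^2\<close>, against \<open>2 * k^2 \<le> 2 * k - t^2\<close>.\<close>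

lemma normal_part_numeric:
  fixes c :: real
  assumes c: "3 / 2 \<le> c" and t: "0 \<le> t" "t * c < 1"
    and le: "A\<^sup>2 + B\<^sup>2 + C\<^sup>2 + d\<^sup>2 \<le> t\<^sup>2 + (c * t\<^sup>2 / 2)\<^sup>2"
    and D: "(1 - A) * d \<le> C * B" and A: "A < 1"
  shows "d \<le> c * t\<^sup>2 / 2"
proof (rule ccontr)
  define k where "k = c * t\<^sup>2 / 2"
  assume "\<not> d \<le> c * t\<^sup>2 / 2"
  then have dk: "k < d" by (simp add: k_def)
  have k: "0 \<le> k" "k \<le> 1 - 1 / c" using small_radius_numeric[OF c t] c by (auto simp: k_def)
  have tk: "t\<^sup>2 = 2 * k / c" using c by (simp add: k_def)
  have "k\<^sup>2 < d\<^sup>2" using dk k by (intro power_strict_mono) auto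
  moreover have "2 * ((1 - A) * d) \<le> B\<^sup>2 + C\<^sup>2" using D sum_squares_bound[of C B] by simp
  moreover have "(1 - A) * k \<le> (1 - A) * d" using dk A by (intro mult_left_mono) auto
  ultimately have "2 * k - 2 * (A * k) < t\<^sup>2 - A\<^sup>2" using le by (simp add: k_def[symmetric] algebra_simps)
  then have "2 * k < t\<^sup>2 + k\<^sup>2" using zero_le_power2[of "A - k"] by (simp add: power2_diff)
  moreover have "k * k \<le> k * (1 - 1 / c)" using k by (intro mult_left_mono) auto
  then have "k\<^sup>2 \<le> k - t\<^sup>2 / 2" unfolding tk by (simp add: power2_eq_square right_diff_distrib)
  then have "2 * k\<^sup>2 \<le> 2 * k - t\<^sup>2" by simp
  ultimately show False using zero_le_power2[of k] by linarith
qed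

text \<open>Equality holds at \<open>Q = \<delta>\<close>,
  \<open>D = k = (1 - q) * \<delta>\<close>. Therefore, with \<open>e = (1 - q) * \<delta>\<close>,
  the difference of squares to be shown nonnegative has the factor \<open>e - D\<close>; the
  cofactor is nonnegative because \<open>(1 + q^2) * (1 - q) \<le> 1\<close>.\<close>

lemma tangent_normal_sum_numeric:
  fixes q :: real
  assumes q: "0 \<le> q" "q \<le> 1" and nn: "0 \<le> \<delta>" "0 \<le> Q" "0 \<le> D"
    and le: "Q\<^sup>2 + D\<^sup>2 \<le> \<delta>\<^sup>2 + k\<^sup>2" "D \<le> k" "k \<le> (1 - q) * \<delta>"
  shows "q * Q + D \<le> \<delta>"
proof -
  define e where "e = (1 - q) * \<delta>"
  have De: "D \<le> e" using le by (simp add: e_def)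
  have ed: "e \<le> \<delta>" unfolding e_def using q nn by (simp add: mult_left_le_one_le)
  have "k\<^sup>2 \<le> e\<^sup>2" using le nn by (intro power_mono) (auto simp: e_def)
  then have "Q\<^sup>2 \<le> \<delta>\<^sup>2 + e\<^sup>2 - D\<^sup>2" using le by simp
  then have "q\<^sup>2 * Q\<^sup>2 \<le> q\<^sup>2 * (\<delta>\<^sup>2 + e\<^sup>2 - D\<^sup>2)" by (intro mult_left_mono) auto
  moreover have "0 \<le> (e - D) * (2 * \<delta> - (1 + q\<^sup>2) * (e + D))"
  proof (rule mult_nonneg_nonneg)
    have "(1 + q\<^sup>2) * (e + D) \<le> (1 + q\<^sup>2) * (2 * e)" using De by (intro mult_left_mono) auto
    also have "\<dots> = 2 * \<delta> * ((1 + q\<^sup>2) * (1 - q))" by (simp add: e_def)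
    also have "\<dots> \<le> 2 * \<delta> * 1"
    proof (rule mult_left_mono)
      have "(1 + q\<^sup>2) * (1 - q) = 1 - (q * (1 - q) + q * q\<^sup>2)" by (simp add: algebra_simps power2_eq_square)
      then show "(1 + q\<^sup>2) * (1 - q) \<le> 1" using q by (smt (verit) mult_nonneg_nonneg zero_le_power2)
    qed (use nn in simp)
    finally show "0 \<le> 2 * \<delta> - (1 + q\<^sup>2) * (e + D)" by simp
  qed (use De in simp)
  moreover have "(e - D) * (2 * \<delta> - (1 + q\<^sup>2) * (e + D)) = (\<delta> - D)\<^sup>2 - q\<^sup>2 * (\<delta>\<^sup>2 + e\<^sup>2 - D\<^sup>2)"
    unfolding e_def power2_eq_square by algebra
  ultimately have "(q * Q)\<^sup>2 \<le> (\<delta> - D)\<^sup>2" by (simp add: power_mult_distrib)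
  then have "q * Q \<le> \<delta> - D" by (rule power2_le_imp_le) (use De ed in simp)
  then show ?thesis by simp
qed

text \<open>The leading part stretches its row space by at least \<open>s r\<close>, and the tail
  has operator norm at most \<open>s r\<close>; this separation is the source of the gap condition.
  Using \<open>s r\<close> instead of the next singular value for the tail keeps the case
  \<open>r = N\<close> uniform.\<close>

lemma truncation_split:
  assumes svd: "is_svd N X s u v" and r: "r \<le> N"
  defines "Y \<equiv> \<Sum>i = 1..r. s i *\<^sub>R outer (u i) (v i)"
  defines "G \<equiv> orth_complement_proj r u" and "F \<equiv> orth_complement_proj r v"
  shows "G *v (Y *v x) = 0" "F *v q = q \<Longrightarrow> Y *v q = 0"
    and "G *v ((X - Y) *v x) = (X - Y) *v x" "F *v f = 0 \<Longrightarrow> (X - Y) *v f = 0"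
    and "1 \<le> r \<Longrightarrow> \<bar>p \<bullet> ((X - Y) *v q)\<bar> \<le> s r * norm p * norm q"
    and "1 \<le> r \<Longrightarrow> F *v f = 0 \<Longrightarrow> s r * norm f \<le> norm (Y *v f)"
proof -
  have u: "orthonormal_upto N u" and v: "orthonormal_upto N v"
    and s0: "\<And>i. i \<in> {1..N} \<Longrightarrow> 0 \<le> s i"
    and s1: "\<And>i j. i \<in> {1..N} \<Longrightarrow> j \<in> {1..N} \<Longrightarrow> i \<le> j \<Longrightarrow> s j \<le> s i"
    and X: "X = (\<Sum>i = 1..N. s i *\<^sub>R outer (u i) (v i))"
    using svd by (auto simp: is_svd_def)
  have ur: "orthonormal_upto r u" and vr: "orthonormal_upto r v"
    using orthonormal_upto_mono[OF _ r] u v by auto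
  have I: "{Suc r..N} \<subseteq> {1..N}" by auto
  have XY: "X - Y = (\<Sum>i = Suc r..N. s i *\<^sub>R outer (u i) (v i))"
  proof -
    have "{1..N} = {1..r} \<union> {Suc r..N}" using r by auto
    then show ?thesis unfolding X Y_def by (subst \<open>{1..N} = _\<close>, subst sum.union_disjoint) auto
  qed
  have "G *v u i = 0" if "i \<in> {1..r}" for i
    unfolding G_def by (rule orth_complement_proj_basis[OF ur that])
  then show "G *v (Y *v x) = 0"
    unfolding Y_def sum_outer_mult_vector
    by (simp add: linear_sum[OF matrix_vector_mul_linear] matrix_vector_mult_scaleR)
  have "G *v u i = u i" if "i \<in> {Suc r..N}" for i
    unfolding G_def using u that r by (intro orth_complement_proj_fixed) (auto simp: orthonormal_upto_def)
  then show "G *v ((X - Y) *v x) = (X - Y) *v x"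
    unfolding XY sum_outer_mult_vector
    by (simp add: linear_sum[OF matrix_vector_mul_linear] matrix_vector_mult_scaleR)
  show "Y *v q = 0" if "F *v q = q"
    unfolding Y_def sum_outer_mult_vector
    using inner_orth_complement_proj[OF vr, of _ q] that by (intro sum.neutral) (auto simp: F_def)
  show "(X - Y) *v f = 0" if "F *v f = 0"
  proof -
    have "f = (\<Sum>i = 1..r. (v i \<bullet> f) *\<^sub>R v i)" using that by (simp add: F_def orth_complement_proj_mult)
    then have "v j \<bullet> f = 0" if "j \<in> {Suc r..N}" for j
      using orthonormal_inner_sum[OF v, of "{1..r}" j "\<lambda>i. v i \<bullet> f"] that r by auto
    then show ?thesis unfolding XY sum_outer_mult_vector by (intro sum.neutral) auto
  qed
  assume r1: "1 \<le> r"
  have sr: "0 \<le> s r" using s0 r r1 by auto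
  have "norm ((X - Y) *v q) \<le> s r * norm q"
    unfolding XY by (rule norm_sum_outer_mult_le[OF u v I]) (use s0 s1 r r1 sr in auto)
  then have "norm p * norm ((X - Y) *v q) \<le> norm p * (s r * norm q)" by (intro mult_left_mono) auto
  then show "\<bar>p \<bullet> ((X - Y) *v q)\<bar> \<le> s r * norm p * norm q"
    using Cauchy_Schwarz_ineq2[of p "(X - Y) *v q"] by (simp add: mult_ac)
  show "s r * norm f \<le> norm (Y *v f)" if "F *v f = 0"
    unfolding Y_def
    by (rule norm_sum_outer_mult_ge[OF ur vr]) (use s1 r r1 sr that in \<open>auto simp: F_def\<close>)
qed

text \<open>
  Let \<open>Y\<close> be the truncation of \<open>X\<close>. In the block decomposition with respect to the singular
  spaces of \<open>Y\<close>, the matrices \<open>Y - M\<close> and \<open>X - M\<close> differ only in the lower right corner, so it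
  suffices to bound the corner \<open>G Z F = - G M F\<close> of \<open>Z = Y - M\<close>. Its largest singular value
  obeys a quadratic inequality because \<open>M\<close> has rank \<open>r\<close>; the gap condition that the corner of \<open>X\<close>
  is dominated by the \<open>r\<close>-th singular value excludes the large solutions.
\<close>
lemma truncation_error_bound:
  fixes M X :: "real ^ 'n ^ 'm"
  assumes M: "is_compact_svd r M \<sigma> a b" and r: "1 \<le> r" "r \<le> N"
    and X: "is_svd N X s u v"
    and svds: "\<And>A :: real ^ 'n ^ 'm. \<exists>s u v. is_svd N A s u v"
    and c: "1 + 1 / sqrt 2 \<le> c" and close: "c * norm (X - M) < \<sigma> r"
  defines "Y \<equiv> \<Sum>i = 1..r. s i *\<^sub>R outer (u i) (v i)"
  defines "k \<equiv> c * (norm (X - M))\<^sup>2 / (2 * \<sigma> r)"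
  shows "(norm (Y - M))\<^sup>2 \<le> (norm (X - M))\<^sup>2 + k\<^sup>2"
    and "norm (orth_complement_proj r a ** (Y - M) ** orth_complement_proj r b) \<le> k"
proof -
  define S where "S = \<sigma> r"
  define G where "G = orth_complement_proj r u"
  define F where "F = orth_complement_proj r v"
  define L where "L = mat 1 - G"
  define K where "K = mat 1 - F"
  define Z where "Z = Y - M"
  define \<delta> where "\<delta> = norm (X - M)"
  define A where "A = norm (L ** Z ** K)"
  define B where "B = norm (L ** Z ** F)"
  define C where "C = norm (G ** Z ** K)"
  define D where "D = G ** Z ** F"
  define w where "w = norm (G ** (X - M) ** F)"
  have svdM: "is_svd r M \<sigma> a b" and S: "0 < S" using M r by (auto simp: is_compact_svd_def S_def)
  have a: "orthonormal_upto r a" and b: "orthonormal_upto r b"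
    and \<sigma>: "\<And>i. i \<in> {1..r} \<Longrightarrow> S \<le> \<sigma> i"
    and Meq: "M = (\<Sum>i = 1..r. \<sigma> i *\<^sub>R outer (a i) (b i))"
    using svdM r by (auto simp: is_svd_def S_def)
  have rankM: "rank M \<le> r" and rankY: "rank Y \<le> r"
    unfolding Meq Y_def by (rule rank_sum_outer_le)+
  have ur: "orthonormal_upto r u" and vr: "orthonormal_upto r v"
    using orthonormal_upto_mono[OF _ r(2)] X by (auto simp: is_svd_def)
  have Gp: "orth_proj G" and Fp: "orth_proj F"
    using ur vr by (auto simp: G_def F_def orth_proj_orth_complement_proj)
  have Lp: "orth_proj L" and Kp: "orth_proj K"
    unfolding L_def K_def by (auto intro: orth_proj_compl Gp Fp)
  note T = truncation_split[OF X r(2), folded Y_def G_def F_def]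
  have GY: "G ** Y = 0" using T(1) by (simp add: matrix_eq matrix_vector_mul_assoc)
  have YF: "Y ** F = 0"
    using T(2)[OF orth_proj_idem[OF Fp]] by (simp add: matrix_eq matrix_vector_mul_assoc)
  have LE: "L ** (X - Y) = 0"
    using T(3) by (simp add: matrix_eq matrix_vector_mul_assoc[symmetric] L_def matrix_vector_mult_diff_rdistrib[of "mat 1"])
  have EK: "(X - Y) ** K = 0"
  proof -
    have "F *v (K *v x) = 0" for x
      using orth_proj_idem[OF Fp] by (simp add: K_def matrix_vector_mult_diff_rdistrib matrix_vector_mult_diff_distrib)
    then show ?thesis using T(4) by (simp add: matrix_eq matrix_vector_mul_assoc[symmetric])
  qed
  have compl: "mat 1 - G = L" "mat 1 - F = K" by (auto simp: L_def K_def)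
  have XM: "X - M = Z + (X - Y)" by (simp add: Z_def)
  have blocks: "\<delta>\<^sup>2 = A\<^sup>2 + B\<^sup>2 + C\<^sup>2 + w\<^sup>2"
  proof -
    have "L ** (X - M) = L ** Z" unfolding XM matrix_add_ldistrib LE by simp
    moreover have "(X - M) ** K = Z ** K"
    proof -
      have "(X - M) ** K = Z ** K + (X - Y) ** K"
        unfolding XM by (simp add: matrix_eq matrix_vector_mul_assoc[symmetric] matrix_vector_mult_add_rdistrib)
      then show ?thesis using EK by simp
    qed
    then have "G ** (X - M) ** K = G ** Z ** K" by (simp add: matrix_mul_assoc[symmetric])
    ultimately show ?thesis
      using orth_proj_blocks[OF Gp Fp, of "X - M"]
      by (simp add: \<delta>_def A_def B_def C_def w_def compl)
  qed
  have Zblocks: "(norm Z)\<^sup>2 = A\<^sup>2 + B\<^sup>2 + C\<^sup>2 + (norm D)\<^sup>2"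
    using orth_proj_blocks[OF Gp Fp, of Z] by (simp add: A_def B_def C_def D_def compl)
  have GM: "G ** M = - (G ** Z)" and MF: "M ** F = - (Z ** F)"
    unfolding Z_def matrix_diff_ldistrib matrix_diff_rdistrib GY YF by simp_all

  \<comment> \<open>\<open>e\<close> is the operator norm of the corner \<open>D\<close>, attained
    at the unit vectors \<open>p\<close> and \<open>q\<close>.\<close>
  obtain so p' q' where D: "is_svd N D so p' q'" using svds by blast
  define e where "e = so 1"
  define p where "p = p' 1"
  define q where "q = q' 1"
  have N1: "1 \<le> N" using r by simp
  note top = svd_top[OF D N1, folded e_def p_def q_def]
  have e0: "0 \<le> e" and np: "norm p = 1" and nq: "norm q = 1" by (rule top)+

  \<comment> \<open>As \<open>G ** Y = 0\<close>, the compressed \<open>M\<close> is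
    \<open>- (G ** Z)\<close>, so it is measured by two blocks of the error itself: \<open>C\<close>
    in Frobenius norm and the corner by its operator norm \<open>e\<close>. The next fact is the
    mirror image.\<close>
  have left: "(norm (y v* (G ** M)))\<^sup>2 \<le> (C\<^sup>2 + e\<^sup>2) * (norm y)\<^sup>2" for y
  proof -
    have "y v* (G ** M) = - (y v* (G ** Z))"
      unfolding GM by (simp add: vector_matrix_mult_def vec_eq_iff sum_negf)
    then have "(norm (y v* (G ** M)))\<^sup>2 = (norm (y v* (G ** Z)))\<^sup>2" by simp
    also have "\<dots> = (norm (F *v (y v* (G ** Z))))\<^sup>2 + (norm (K *v (y v* (G ** Z))))\<^sup>2"
      using orth_proj_pythagoras[OF Fp, of "y v* (G ** Z)"]
      by (simp add: K_def matrix_vector_mult_diff_rdistrib)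
    also have "\<dots> = (norm (y v* D))\<^sup>2 + (norm (y v* (G ** Z ** K)))\<^sup>2"
      unfolding orth_proj_vector_matrix[OF Fp, symmetric] orth_proj_vector_matrix[OF Kp, symmetric]
      by (simp add: vector_matrix_mul_assoc D_def)
    also have "\<dots> \<le> (e * norm y)\<^sup>2 + (C * norm y)\<^sup>2"
      unfolding C_def by (intro add_mono power_mono top norm_vector_matrix_mult_le) auto
    finally show ?thesis by (simp add: power_mult_distrib algebra_simps)
  qed
  have right: "(norm (M *v (F *v x)))\<^sup>2 \<le> (B\<^sup>2 + e\<^sup>2) * (norm x)\<^sup>2" for x
  proof -
    have "M *v (F *v x) = - ((Z ** F) *v x)"
      unfolding matrix_vector_mul_assoc MF by (simp add: matrix_vector_mult_def vec_eq_iff sum_negf)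
    then have "(norm (M *v (F *v x)))\<^sup>2 = (norm ((Z ** F) *v x))\<^sup>2" by simp
    also have "\<dots> = (norm (G *v ((Z ** F) *v x)))\<^sup>2 + (norm (L *v ((Z ** F) *v x)))\<^sup>2"
      using orth_proj_pythagoras[OF Gp, of "(Z ** F) *v x"]
      by (simp add: L_def matrix_vector_mult_diff_rdistrib)
    also have "\<dots> = (norm (D *v x))\<^sup>2 + (norm ((L ** Z ** F) *v x))\<^sup>2"
      by (simp add: matrix_vector_mul_assoc D_def matrix_mul_assoc)
    also have "\<dots> \<le> (e * norm x)\<^sup>2 + (B * norm x)\<^sup>2"
      unfolding B_def by (intro add_mono power_mono top norm_matrix_vector_mult_le) auto
    finally show ?thesis by (simp add: power_mult_distrib algebra_simps)
  qed
  have MFnorm: "(norm (M ** F))\<^sup>2 = B\<^sup>2 + (norm D)\<^sup>2"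
    using orth_proj_pythagoras_left[OF Gp, of "Z ** F"]
    by (simp add: MF compl B_def D_def matrix_mul_assoc)

  \<comment> \<open>Only the right factor is summed over columns. The left one keeps the operator
    norm \<open>e\<close>, for which a quadratic bound is obtained separately.\<close>
  have corner: "S\<^sup>2 * (norm D)\<^sup>2 \<le> (C\<^sup>2 + e\<^sup>2) * (B\<^sup>2 + (norm D)\<^sup>2)"
  proof -
    let ?k = "sqrt (C\<^sup>2 + e\<^sup>2)"
    have "norm (D *v x) \<le> ?k / S * norm ((M ** F) *v x)" for x
    proof -
      define y where "y = D *v x"
      have Dx: "y = - (G *v (M *v (F *v x)))"
        by (simp add: y_def D_def matrix_vector_mul_assoc[symmetric] Z_def T(1)
            matrix_vector_mult_diff_rdistrib matrix_vector_mult_diff_distrib)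
      have Gy: "G *v y = y" by (simp add: Dx matrix_vector_mult_minus_right orth_proj_idem[OF Gp])
      have "y \<bullet> y = - ((G *v y) \<bullet> (M *v (F *v x)))"
        by (simp add: Dx orth_proj_inner[OF Gp, symmetric] matrix_vector_mult_minus_right orth_proj_idem[OF Gp])
      then have "S * (norm y)\<^sup>2 = S * \<bar>y \<bullet> (M *v (F *v x))\<bar>"
        unfolding Gy power2_norm_eq_inner by (metis abs_minus_cancel abs_of_nonneg inner_ge_zero)
      also have "\<dots> \<le> norm (y v* M) * norm (M *v (F *v x))"
        unfolding Meq by (rule inner_sum_outer_mult_le[OF a b \<sigma>]) (use S in auto)
      also have "y v* M = y v* (G ** M)"
        using Gy orth_proj_vector_matrix[OF Gp, of y] by (simp add: vector_matrix_mul_assoc[symmetric])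
      also have "norm (y v* (G ** M)) \<le> ?k * norm y"
        by (rule power2_le_imp_le) (use left[of y] in \<open>simp_all add: power_mult_distrib\<close>)
      finally have "S * (norm y)\<^sup>2 \<le> ?k * norm y * norm (M *v (F *v x))"
        by (simp add: mult_right_mono)
      then have "norm y * (S * norm y) \<le> norm y * (?k * norm (M *v (F *v x)))"
        by (simp add: power2_eq_square mult_ac)
      then have "S * norm y \<le> ?k * norm (M *v (F *v x))"
        by (cases "y = 0") simp_all
      then show ?thesis using S by (simp add: y_def[symmetric] field_simps matrix_vector_mul_assoc)
    qed
    then have "norm D \<le> ?k / S * norm (M ** F)"
      using S by (intro norm_matrix_le_pointwise) auto
    then have "S * norm D \<le> ?k * norm (M ** F)" using S by (simp add: field_simps)
    then have "(S * norm D)\<^sup>2 \<le> (?k * norm (M ** F))\<^sup>2" using S by (intro power_mono) auto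
    then show ?thesis by (simp add: power_mult_distrib MFnorm)
  qed

  have top_rel: "G *v p = p \<and> F *v q = q \<and> p \<bullet> (M *v q) = - e" if "0 < e"
  proof -
    have Dq: "D *v q = e *\<^sub>R p" and pD: "p v* D = e *\<^sub>R q" by (rule top)+
    have "G *v (D *v q) = D *v q"
      by (simp add: D_def matrix_vector_mul_assoc[symmetric] orth_proj_idem[OF Gp])
    then have Gpp: "G *v p = p" using Dq that by (simp add: matrix_vector_mult_scaleR)
    have "F *v (p v* D) = p v* D"
      using Fp unfolding orth_proj_vector_matrix[OF Fp, symmetric]
      by (simp add: D_def vector_matrix_mul_assoc matrix_mul_assoc[symmetric] orth_proj_def)
    then have Fq: "F *v q = q" using pD that by (simp add: matrix_vector_mult_scaleR)
    have "p \<bullet> (D *v q) = e" using Dq np by (simp add: dot_square_norm)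
    moreover have "D *v q = - (G *v (M *v q))"
      using T(2)[OF Fq] Fq
      by (simp add: D_def matrix_vector_mul_assoc[symmetric] Z_def matrix_vector_mult_diff_rdistrib matrix_vector_mult_minus_right)
    ultimately show ?thesis using Gpp Fq orth_proj_inner[OF Gp, of p "M *v q"] by simp
  qed
  \<comment> \<open>The same pseudo-inverse inequality at the top singular pair, where the two
    factors are merged by the arithmetic-geometric mean.\<close>
  have quad: "S * e \<le> (B\<^sup>2 + C\<^sup>2) / 2 + e\<^sup>2"
  proof (cases "0 < e")
    case True
    note pq = top_rel[OF True]
    have "p v* M = p v* (G ** M)"
      using pq orth_proj_vector_matrix[OF Gp, of p] by (simp add: vector_matrix_mul_assoc[symmetric])
    then have 1: "(norm (p v* M))\<^sup>2 \<le> C\<^sup>2 + e\<^sup>2" using left[of p] np by simp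
    have 2: "(norm (M *v q))\<^sup>2 \<le> B\<^sup>2 + e\<^sup>2" using right[of q] pq nq by simp
    have "S * \<bar>p \<bullet> (M *v q)\<bar> \<le> norm (p v* M) * norm (M *v q)"
      unfolding Meq by (rule inner_sum_outer_mult_le[OF a b \<sigma>]) (use S in auto)
    also have "\<dots> \<le> ((norm (p v* M))\<^sup>2 + (norm (M *v q))\<^sup>2) / 2"
      using sum_squares_bound[of "norm (p v* M)" "norm (M *v q)"] by simp
    finally have "S * e \<le> ((norm (p v* M))\<^sup>2 + (norm (M *v q))\<^sup>2) / 2" using pq e0 by simp
    also have "\<dots> \<le> ((C\<^sup>2 + e\<^sup>2) + (B\<^sup>2 + e\<^sup>2)) / 2"
      using 1 2 by (intro divide_right_mono add_mono) auto
    finally show ?thesis by (simp add: add_divide_distrib)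
  next
    case False
    then show ?thesis using e0 by simp
  qed
  have gap: "e - B * C / e \<le> A + w" if e: "0 < e"
  proof -
    note pq = top_rel[OF e]
    have q0: "q \<noteq> 0" using nq by auto
    \<comment> \<open>This kernel vector of \<open>M\<close> gives two estimates. Tested against
      \<open>p\<close> it yields \<open>\<bar>g\<bar> * e \<le> C * norm f\<close>; its image under
      \<open>Y\<close>, which is at least \<open>s r * norm f\<close>, then yields
      \<open>s r \<le> A + B * C / e\<close>.\<close>
    obtain f g where f: "F *v f = 0" "f \<noteq> 0 \<or> g \<noteq> 0" "M *v (f + g *\<^sub>R q) = 0"
      using null_vector[OF rankM vr q0] pq unfolding F_def by metis
    have Mf: "M *v f = - g *\<^sub>R (M *v q)"
      using f(3) by (simp add: matrix_vector_right_distrib matrix_vector_mult_scaleR eq_neg_iff_add_eq_0)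
    have Kf: "K *v f = f" using f by (simp add: K_def matrix_vector_mult_diff_rdistrib)
    have Zf: "M *v f = Y *v f - Z *v f" by (simp add: Z_def matrix_vector_mult_diff_rdistrib)
    have "p \<bullet> (M *v f) = g * e" using pq by (simp add: Mf)
    moreover have "p \<bullet> (Y *v f) = 0"
      using T(1) pq orth_proj_inner[OF Gp, of p "Y *v f"] by simp
    moreover have "p \<bullet> (Z *v f) = p \<bullet> ((G ** Z ** K) *v f)"
      using pq Kf orth_proj_inner[OF Gp, of p "Z *v f"] by (simp add: matrix_vector_mul_assoc[symmetric])
    ultimately have "g * e = - (p \<bullet> ((G ** Z ** K) *v f))" unfolding Zf by (simp add: inner_diff_right)
    then have "\<bar>g\<bar> * e \<le> norm p * norm ((G ** Z ** K) *v f)"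
      using Cauchy_Schwarz_ineq2[of p "(G ** Z ** K) *v f"] e by (metis abs_minus_cancel abs_mult abs_of_pos)
    also have "\<dots> \<le> C * norm f" using norm_matrix_vector_mult_le[of "G ** Z ** K" f] np by (simp add: C_def)
    finally have ge: "\<bar>g\<bar> * e \<le> C * norm f" .
    have f0: "f \<noteq> 0" using ge f(2) e by (auto simp: mult_le_0_iff)
    have YL: "Y *v f = L *v (Y *v f)" using T(1) by (simp add: L_def matrix_vector_mult_diff_rdistrib)
    have YZ: "Y *v f = Z *v f + g *\<^sub>R (Z *v q)"
      using Mf T(2)[of q] pq by (simp add: Z_def matrix_vector_mult_diff_rdistrib)
    have "L *v (Y *v f) = (L ** Z ** K) *v f + g *\<^sub>R ((L ** Z ** F) *v q)"
      unfolding YZ using Kf pq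
      by (simp add: matrix_vector_mul_assoc[symmetric] matrix_vector_right_distrib matrix_vector_mult_scaleR)
    with YL have Yf: "Y *v f = (L ** Z ** K) *v f + g *\<^sub>R ((L ** Z ** F) *v q)" by (rule trans)
    have "norm (Y *v f) \<le> norm ((L ** Z ** K) *v f) + \<bar>g\<bar> * norm ((L ** Z ** F) *v q)"
      unfolding Yf norm_scaleR[symmetric] by (rule norm_triangle_ineq)
    also have "\<dots> \<le> A * norm f + \<bar>g\<bar> * B"
    proof (rule add_mono)
      show "norm ((L ** Z ** K) *v f) \<le> A * norm f"
        unfolding A_def by (rule norm_matrix_vector_mult_le)
      have "norm ((L ** Z ** F) *v q) \<le> B * norm q"
        unfolding B_def by (rule norm_matrix_vector_mult_le)
      then have "norm ((L ** Z ** F) *v q) \<le> B" by (simp add: nq)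
      then show "\<bar>g\<bar> * norm ((L ** Z ** F) *v q) \<le> \<bar>g\<bar> * B" by (rule mult_left_mono) simp
    qed
    also have "\<bar>g\<bar> * B \<le> C * norm f / e * B"
    proof (rule mult_right_mono)
      show "\<bar>g\<bar> \<le> C * norm f / e" using ge e by (simp add: pos_le_divide_eq)
    qed (simp add: B_def)
    finally have "norm (Y *v f) \<le> (A + B * C / e) * norm f" by (simp add: algebra_simps)
    then have "s r * norm f \<le> (A + B * C / e) * norm f" using T(6)[OF r(1) f(1)] by simp
    then have sr: "s r \<le> A + B * C / e" using f0 by simp
    \<comment> \<open>The reverse comparison \<open>e \<le> w + s r\<close>: between
      \<open>p\<close> and \<open>q\<close>, the matrix \<open>Y\<close> contributes nothing,
      \<open>- M\<close> contributes \<open>e\<close>, and the tail is at most \<open>s r\<close> in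
      absolute value.\<close>
    have "p \<bullet> ((X - M) *v q) = p \<bullet> (Y *v q) - p \<bullet> (M *v q) + p \<bullet> ((X - Y) *v q)"
      by (simp add: matrix_vector_mult_diff_rdistrib inner_diff_right)
    then have "e + p \<bullet> ((X - Y) *v q) = p \<bullet> ((X - M) *v q)"
      using pq T(2)[of q] by simp
    also have "\<dots> = p \<bullet> ((G ** (X - M) ** F) *v q)"
      using pq orth_proj_inner[OF Gp, of p "(X - M) *v q"] by (simp add: matrix_vector_mul_assoc[symmetric])
    also have "\<dots> \<le> w"
      using norm_cauchy_schwarz[of p "(G ** (X - M) ** F) *v q"] norm_matrix_vector_mult_le[of "G ** (X - M) ** F" q]
      by (simp add: w_def np nq)
    finally have "e \<le> w + s r" using T(5)[OF r(1), of p q] by (simp add: np nq abs_le_iff)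
    then show ?thesis using sr by simp
  qed

  define t where "t = \<delta> / S"
  have c32: "3 / 2 \<le> c"
  proof -
    have "1 / 2 \<le> 1 / sqrt 2" using sqrt2_less_2 by (intro divide_left_mono) auto
    then show ?thesis using c by linarith
  qed
  have t: "0 \<le> t" "t * c < 1"
    using close S by (auto simp: t_def \<delta>_def S_def field_simps)
  have nn: "0 \<le> A" "0 \<le> B" "0 \<le> C" "0 \<le> w" "0 \<le> norm D"
    by (auto simp: A_def B_def C_def w_def)
  have nnS: "0 \<le> A / S" "0 \<le> B / S" "0 \<le> C / S" "0 \<le> w / S" "0 \<le> norm D / S" "0 \<le> e / S"
    using nn e0 S by simp_all
  note sc = power_divide add_divide_distrib[symmetric]
  have hyp: "(A / S)\<^sup>2 + (B / S)\<^sup>2 + (C / S)\<^sup>2 + (w / S)\<^sup>2 \<le> t\<^sup>2"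
    unfolding t_def sc blocks by simp
  have num: "e / S \<le> c * ((B / S)\<^sup>2 + (C / S)\<^sup>2) / 2"
  proof (rule top_corner_numeric(1)[OF c t, of "A / S" "B / S" "C / S" "e / S" "w / S"])
    have "S * e / S\<^sup>2 \<le> ((B\<^sup>2 + C\<^sup>2) / 2 + e\<^sup>2) / S\<^sup>2" using quad by (intro divide_right_mono) auto
    then show "e / S \<le> ((B / S)\<^sup>2 + (C / S)\<^sup>2) / 2 + (e / S)\<^sup>2"
      using S by (simp add: power_divide add_divide_distrib power2_eq_square)
    show "e / S - B / S * (C / S) / (e / S) \<le> A / S + w / S" if "0 < e / S"
    proof -
      have "(e - B * C / e) / S \<le> (A + w) / S"
        using gap that S by (intro divide_right_mono) (auto simp: zero_less_divide_iff)
      then show ?thesis using S by (simp add: diff_divide_distrib add_divide_distrib mult.commute)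
    qed
  qed (fact hyp nnS)+
  have ct: "c * t\<^sup>2 / 2 = k / S"
    using S by (simp add: k_def t_def \<delta>_def S_def power2_eq_square)
  have "norm D / S \<le> c * t\<^sup>2 / 2"
  proof (rule corner_numeric[OF c32 t, of "B / S" "C / S" "norm D / S" "e / S"])
    show "(B / S)\<^sup>2 + (C / S)\<^sup>2 \<le> t\<^sup>2" using hyp zero_le_power2[of "A / S"] zero_le_power2[of "w / S"] by linarith
    have "S\<^sup>2 * (norm D)\<^sup>2 / (S\<^sup>2 * S\<^sup>2) \<le> (C\<^sup>2 + e\<^sup>2) * (B\<^sup>2 + (norm D)\<^sup>2) / (S\<^sup>2 * S\<^sup>2)"
      using corner by (intro divide_right_mono) auto
    moreover have "S\<^sup>2 * (norm D)\<^sup>2 / (S\<^sup>2 * S\<^sup>2) = (norm D / S)\<^sup>2"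
      unfolding power_divide by (rule mult_divide_mult_cancel_left) (use S in simp)
    moreover have "(C\<^sup>2 + e\<^sup>2) * (B\<^sup>2 + (norm D)\<^sup>2) / (S\<^sup>2 * S\<^sup>2)
        = ((C / S)\<^sup>2 + (e / S)\<^sup>2) * ((B / S)\<^sup>2 + (norm D / S)\<^sup>2)"
      unfolding sc times_divide_times_eq ..
    ultimately show "(norm D / S)\<^sup>2 \<le> ((C / S)\<^sup>2 + (e / S)\<^sup>2) * ((B / S)\<^sup>2 + (norm D / S)\<^sup>2)"
      by simp
  qed (fact num nnS)+
  then have Dk: "norm D \<le> k" using S unfolding ct by (simp add: divide_le_cancel)
  have "(norm D)\<^sup>2 \<le> k\<^sup>2" using Dk by (intro power_mono) auto
  then have ZB: "(norm Z)\<^sup>2 \<le> \<delta>\<^sup>2 + k\<^sup>2" using Zblocks blocks zero_le_power2[of w] by linarith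
  then show "(norm (Y - M))\<^sup>2 \<le> (norm (X - M))\<^sup>2 + k\<^sup>2" unfolding Z_def \<delta>_def .

  \<comment> \<open>From here the blocks refer to the singular spaces of \<open>M\<close>. There
    \<open>M\<close> has no normal part, and the rank of \<open>Y\<close> makes its normal block a
    Schur complement.\<close>
  define P where "P = orth_complement_proj r a"
  define Q where "Q = orth_complement_proj r b"
  define A' where "A' = norm ((mat 1 - P) ** Z ** (mat 1 - Q))"
  define B' where "B' = norm ((mat 1 - P) ** Z ** Q)"
  define C' where "C' = norm (P ** Z ** (mat 1 - Q))"
  have Pp: "orth_proj P" and Qp: "orth_proj Q"
    unfolding P_def Q_def by (rule orth_proj_orth_complement_proj, fact)+
  have PZ: "P ** Z ** Q = P ** Y ** Q"
  proof -
    have "P *v (M *v x) = 0" for x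
      unfolding P_def Meq by (rule truncation_split(1)[OF svdM order_refl])
    then have "P ** M = 0" by (simp add: matrix_eq matrix_vector_mul_assoc[symmetric])
    then show ?thesis by (simp add: Z_def matrix_diff_ldistrib)
  qed
  have le: "A'\<^sup>2 + B'\<^sup>2 + C'\<^sup>2 + (norm (P ** Y ** Q))\<^sup>2 \<le> \<delta>\<^sup>2 + k\<^sup>2"
  proof -
    have "(norm Z)\<^sup>2 = A'\<^sup>2 + B'\<^sup>2 + C'\<^sup>2 + (norm (P ** Y ** Q))\<^sup>2"
      using orth_proj_blocks[OF Pp Qp, of Z] unfolding A'_def B'_def C'_def PZ by simp
    then show ?thesis using ZB by (simp only:)
  qed
  have le': "(A' / S)\<^sup>2 + (B' / S)\<^sup>2 + (C' / S)\<^sup>2 + (norm (P ** Y ** Q) / S)\<^sup>2 \<le> t\<^sup>2 + (c * t\<^sup>2 / 2)\<^sup>2"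
    unfolding ct using divide_right_mono[OF le, of "S\<^sup>2"] unfolding t_def sc by simp
  \<comment> \<open>The Schur bound needs an invertible upper left block; the radius suffices since
    \<open>t^2 \<le> 4 / 9\<close> and the added square is at most \<open>1 / 9\<close>.\<close>
  have A1: "A' / S < 1"
  proof -
    have "t\<^sup>2 + (c * t\<^sup>2 / 2)\<^sup>2 < 1"
    proof -
      have "c * t\<^sup>2 / 2 \<le> 1 / 3" "0 \<le> c * t\<^sup>2 / 2" using small_radius_numeric[OF c32 t] c32 by auto
      then have "(c * t\<^sup>2 / 2)\<^sup>2 \<le> (1 / 3)\<^sup>2" by (intro power_mono) auto
      moreover have "3 / 2 * t\<^sup>2 \<le> c * t\<^sup>2" using c32 by (intro mult_right_mono) auto
      moreover have "(1 / 3 :: real)\<^sup>2 = 1 / 9" by (simp add: power2_eq_square)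
      ultimately show ?thesis using small_radius_numeric(2)[OF c32 t] by linarith
    qed
    then have "(A' / S)\<^sup>2 < 1\<^sup>2"
      using le' zero_le_power2[of "B' / S"] zero_le_power2[of "C' / S"] zero_le_power2[of "norm (P ** Y ** Q) / S"]
      unfolding one_power2 by linarith
    then show ?thesis by (rule power2_less_imp_less) simp
  qed
  have AS: "A' < S" using A1 S by simp
  have "(S - A') * norm (P ** Y ** Q) \<le> C' * B'"
    unfolding A'_def B'_def C'_def P_def Q_def Z_def
  proof (rule schur_complement_bound[where r = r and s = \<sigma> and c = S and u = a and v = b and M = M and Y = Y])
    show "norm ((mat 1 - orth_complement_proj r a) ** (Y - M) ** (mat 1 - orth_complement_proj r b)) < S"
      using AS unfolding A'_def P_def Q_def Z_def .
    show "S \<le> \<sigma> i" if "i \<in> {1..r}" for i using \<sigma>[OF that] .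
    show "0 \<le> S" using S by simp
  qed (rule a b Meq rankY)+
  then have "(S - A') * norm (P ** Y ** Q) / S\<^sup>2 \<le> C' * B' / S\<^sup>2"
    by (rule divide_right_mono) simp
  moreover have "1 - A' / S = (S - A') / S" using S by (simp add: diff_divide_distrib)
  ultimately have "(1 - A' / S) * (norm (P ** Y ** Q) / S) \<le> C' / S * (B' / S)"
    by (simp only: times_divide_times_eq power2_eq_square)
  from normal_part_numeric[OF c32 t le' this A1] have "norm (P ** Y ** Q) / S \<le> k / S" by (simp add: ct)
  then have "norm (P ** Z ** Q) \<le> k" unfolding PZ using S by (simp add: divide_le_cancel)
  then show "norm (orth_complement_proj r a ** (Y - M) ** orth_complement_proj r b) \<le> k"
    unfolding P_def Q_def Z_def .
qed

section \<open>The scalar recursion\<close>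

text \<open>Convergence must be secured first: otherwise \<open>exp_integral_E1\<close> would be
  only a default value of \<open>integral\<close>.\<close>

lemma integrable_exp_neg_div:
  fixes t :: real
  assumes "t > 0"
  shows "(\<lambda>z. exp (- z) / z) integrable_on {t..}"
proof (rule measurable_bounded_by_integrable_imp_integrable)
  show "(\<lambda>z. exp (- z) / z) \<in> borel_measurable (lebesgue_on {t..})"
    using assms by (intro continuous_imp_measurable_on_sets_lebesgue continuous_intros) auto
  show "(\<lambda>z. exp (- 1 * z) / t) integrable_on {t..}"
    using has_integral_exp_minus_to_infinity[of 1 t]
    by (intro integrable_on_divide) (auto simp: has_integral_integrable)
  show "norm (exp (- z) / z) \<le> exp (- 1 * z) / t" if "z \<in> {t..}" for z
    using that assms by (auto intro!: divide_left_mono mult_pos_pos)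
qed auto

lemma exp_integral_E1_diff:
  fixes s t :: real
  assumes "0 < s" "s \<le> t"
  shows "((\<lambda>z. exp (- z) / z) has_integral exp_integral_E1 s - exp_integral_E1 t) {s..t}"
proof -
  let ?f = "\<lambda>z::real. exp (- z) / z"
  have i: "?f integrable_on {s..t}"
    using assms by (intro integrable_continuous_interval continuous_intros) auto
  have j: "(?f has_integral exp_integral_E1 t) {t..}"
    unfolding exp_integral_E1_def using integrable_exp_neg_div[of t] assms by (simp add: integrable_integral)
  have "negligible ({s..t} \<inter> {t..})"
    using assms by (intro negligible_subset[OF negligible_sing[of t]]) auto
  then have "(?f has_integral integral {s..t} ?f + exp_integral_E1 t) ({s..t} \<union> {t..})"
    by (rule has_integral_Un[OF integrable_integral[OF i] j])
  moreover have "{s..t} \<union> {t..} = {s..}" using assms by auto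
  ultimately have "exp_integral_E1 s = integral {s..t} ?f + exp_integral_E1 t"
    unfolding exp_integral_E1_def by (simp add: integral_unique)
  then show ?thesis using i by (simp add: integrable_integral)
qed

text \<open>After multiplying out, the difference \<open>f\<close> of the two sides vanishes at
  \<open>0\<close>, and its derivative is \<open>((exp x - 1)^2 + 1) / (2 * exp x)\<close>.\<close>

lemma exp_minus_1_bound:
  fixes z :: real
  assumes "z > 0"
  shows "1 / (exp z - 1) \<le> exp (- z) / z + 1 / (2 * z)"
proof -
  define f where "f = (\<lambda>z::real. 1 - exp (- z) + (exp z - 1) / 2 - z)"
  have "f 0 \<le> f z"
  proof (rule DERIV_nonneg_imp_nondecreasing[where f = f])
    fix x :: real
    have "exp (- x) + exp x / 2 - 1 \<ge> 0"
    proof -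
      have "exp (- x) + exp x / 2 - 1 = (exp x - 1)\<^sup>2 / (2 * exp x) + exp (- x) / 2"
        by (simp add: field_simps power2_eq_square exp_minus)
      then show ?thesis by simp
    qed
    then show "\<exists>y. (f has_real_derivative y) (at x) \<and> 0 \<le> y"
      unfolding f_def by (intro exI[of _ "exp (- x) + exp x / 2 - 1"]) (auto intro!: derivative_eq_intros)
  qed (use assms in auto)
  then have *: "z \<le> (exp z - 1) * (exp (- z) + 1 / 2)"
    by (simp add: f_def field_simps exp_minus)
  have "0 < exp z - 1" using assms by simp
  then have "1 / (exp z - 1) \<le> (exp (- z) + 1 / 2) / z"
    using * assms by (simp add: field_simps)
  then show ?thesis by (simp add: add_divide_distrib)
qed

text \<open>\<open>ln (1 - exp (- z))\<close> is an antiderivative of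
  \<open>1 / (exp z - 1)\<close>, so this is the preceding pointwise bound integrated over
  \<open>{s..t}\<close>.\<close>

lemma log_ratio_le_E1_diff:
  fixes s t :: real
  assumes "0 < s" "s \<le> t"
  shows "ln ((1 - exp (- t)) / (1 - exp (- s)))
    \<le> exp_integral_E1 s - exp_integral_E1 t + 1 / 2 * ln (t / s)"
proof -
  have 1: "((\<lambda>z. 1 / (exp z - 1)) has_integral ln (1 - exp (- t)) - ln (1 - exp (- s))) {s..t}"
  proof (rule fundamental_theorem_of_calculus)
    fix z assume "z \<in> {s..t}"
    then have "z > 0" using assms by auto
    have "((\<lambda>z. ln (1 - exp (- z))) has_real_derivative 1 / (1 - exp (- z)) * exp (- z)) (at z)"
    proof (rule DERIV_chain2[OF DERIV_ln_divide])
      show "((\<lambda>z. 1 - exp (- z)) has_real_derivative exp (- z)) (at z)"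
        by (auto intro!: derivative_eq_intros)
    qed (use \<open>z > 0\<close> in simp)
    moreover have "1 / (1 - exp (- z)) * exp (- z) = 1 / (exp z - 1)"
      using \<open>z > 0\<close> by (simp add: exp_minus frac_eq_eq right_diff_distrib)
    ultimately have "((\<lambda>z. ln (1 - exp (- z))) has_real_derivative 1 / (exp z - 1)) (at z)"
      by simp
    then show "((\<lambda>z. ln (1 - exp (- z))) has_vector_derivative 1 / (exp z - 1)) (at z within {s..t})"
      by (simp add: has_real_derivative_iff_has_vector_derivative has_vector_derivative_at_within)
  qed fact
  have 2: "((\<lambda>z. 1 / (2 * z)) has_integral ln t / 2 - ln s / 2) {s..t}"
  proof (rule fundamental_theorem_of_calculus)
    fix z assume "z \<in> {s..t}"
    then have "z > 0" using assms by auto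
    then have "((\<lambda>z. ln z / 2) has_real_derivative 1 / (2 * z)) (at z)"
      using DERIV_cdivide[OF DERIV_ln_divide, of z 2] by (simp add: mult.commute)
    then show "((\<lambda>z. ln z / 2) has_vector_derivative 1 / (2 * z)) (at z within {s..t})"
      by (simp add: has_real_derivative_iff_has_vector_derivative has_vector_derivative_at_within)
  qed fact
  have "ln (1 - exp (- t)) - ln (1 - exp (- s))
      \<le> exp_integral_E1 s - exp_integral_E1 t + (ln t / 2 - ln s / 2)"
  proof (rule has_integral_le[OF 1 has_integral_add[OF exp_integral_E1_diff[OF assms] 2]])
    show "1 / (exp z - 1) \<le> exp (- z) / z + 1 / (2 * z)" if "z \<in> {s..t}" for z
      using that assms by (intro exp_minus_1_bound) simp
  qed
  moreover have "ln ((1 - exp (- t)) / (1 - exp (- s))) = ln (1 - exp (- t)) - ln (1 - exp (- s))"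
    "ln (t / s) = ln t - ln s"
    using assms by (simp_all add: ln_div)
  ultimately show ?thesis by (simp add: diff_divide_distrib)
qed

section \<open>A Lyapunov function for the quadratic recursion\<close>

lemma bernoulli_ln:
  fixes \<rho> w :: real
  assumes "0 < \<rho>" "\<rho> \<le> 1" "0 \<le> w"
  shows "\<rho> * ln (1 + w / \<rho>) \<le> ln (1 + w)"
proof -
  have c: "concave_on {0<..} (ln :: real \<Rightarrow> real)" by (rule ln_concave)
  have "ln ((1 - \<rho>) *\<^sub>R 1 + \<rho> *\<^sub>R (1 + w / \<rho>)) \<ge> (1 - \<rho>) * ln 1 + \<rho> * ln (1 + w / \<rho>)"
    by (rule concave_onD[OF c]) (use assms in \<open>auto intro!: add_pos_nonneg\<close>)
  then show ?thesis using assms by (simp add: algebra_simps)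
qed

text \<open>
  If \<open>b' = b * (\<rho> + (1 - \<rho>) * b)\<close>, then \<open>(1 - b') / (1 - b) = 1 + (1 - \<rho>) * b\<close>, which reduces the
  claim to Bernoulli's inequality.
\<close>
lemma lyapunov_step:
  fixes \<rho> b b' :: real
  assumes "0 < \<rho>" "\<rho> \<le> 1" "0 \<le> b" "b < 1" "0 \<le> b'" "b' \<le> b * (\<rho> + (1 - \<rho>) * b)"
  shows "b' * (1 - b') powr (- 1 / \<rho>) \<le> \<rho> * (b * (1 - b) powr (- 1 / \<rho>))"
proof -
  define w where "w = (1 - \<rho>) * b"
  define c where "c = b * (\<rho> + w)"
  have w: "0 \<le> w" "w < 1" "\<rho> + w \<le> 1"
  proof -
    show "0 \<le> w" using assms by (auto simp: w_def)
    have "w \<le> (1 - \<rho>) * 1" unfolding w_def using assms by (intro mult_left_mono) auto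
    then show "\<rho> + w \<le> 1" "w < 1" using assms by auto
  qed
  have cb: "c \<le> b" "0 \<le> c" unfolding c_def using assms w by (auto simp: mult_left_le)
  have fac: "1 - c = (1 - b) * (1 + w)" by (simp add: c_def w_def algebra_simps)
  \<comment> \<open>The exponent \<open>1 / \<rho>\<close> is chosen so that
    \<open>ln (1 + w / \<rho>)\<close> and \<open>ln (1 + w) / \<rho>\<close> agree to first order
    in \<open>w\<close>.\<close>
  have p: "(1 + w) powr (- 1 / \<rho>) * (\<rho> + w) \<le> \<rho>"
  proof -
    have "ln (1 + w / \<rho>) \<le> ln (1 + w) / \<rho>"
      using bernoulli_ln[of \<rho> w] assms w by (simp add: field_simps)
    then have "exp (ln (1 + w / \<rho>)) \<le> exp (ln (1 + w) / \<rho>)" by simp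
    moreover have "0 < 1 + w / \<rho>" using assms w by (auto intro!: add_pos_nonneg)
    ultimately have "1 + w / \<rho> \<le> (1 + w) powr (1 / \<rho>)"
      using w by (simp add: powr_def)
    then have "(\<rho> + w) / \<rho> \<le> (1 + w) powr (1 / \<rho>)" using assms by (simp add: field_simps)
    then have "\<rho> + w \<le> \<rho> * (1 + w) powr (1 / \<rho>)" using assms by (simp add: field_simps)
    then have "(1 + w) powr (- 1 / \<rho>) * (\<rho> + w)
        \<le> (1 + w) powr (- 1 / \<rho>) * (\<rho> * (1 + w) powr (1 / \<rho>))"
      by (intro mult_left_mono) auto
    also have "\<dots> = \<rho> * ((1 + w) powr (- 1 / \<rho>) * (1 + w) powr (1 / \<rho>))" by simp
    also have "\<dots> = \<rho>" using w by (simp only: powr_add[symmetric]) simp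
    finally show ?thesis .
  qed
  have "b' * (1 - b') powr (- 1 / \<rho>) \<le> c * (1 - c) powr (- 1 / \<rho>)"
    using assms cb by (intro mult_mono powr_mono2') (auto simp: c_def w_def)
  also have "\<dots> = b * (1 - b) powr (- 1 / \<rho>) * ((1 + w) powr (- 1 / \<rho>) * (\<rho> + w))"
    unfolding fac using assms w by (simp add: powr_mult c_def)
  also have "\<dots> \<le> b * (1 - b) powr (- 1 / \<rho>) * \<rho>"
    using p assms by (intro mult_left_mono) auto
  finally show ?thesis by (simp add: mult_ac)
qed

text \<open>A crude geometric bound with ratio \<open>q\<close> confines the sequence below \<tau>
  and gives the limit, including the case \<open>\<rho> = 0\<close> where the Lyapunov exponent
  makes no sense. The sharp bound carries \<open>\<rho> ^ k\<close> at index \<open>Suc k\<close>,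
  because the step from \<open>0\<close> to \<open>1\<close> is not assumed to contract.\<close>

lemma recursion_bounds:
  fixes \<rho> \<tau> :: real and b :: "nat \<Rightarrow> real"
  assumes "\<rho> < 1" "0 \<le> \<rho>" "\<tau> < 1"
    and nonneg: "\<And>k. 0 \<le> b k" and b0: "b 0 = \<tau>" and b1: "b 1 \<le> \<tau>"
    and rec: "\<And>k. 1 \<le> k \<Longrightarrow> b (Suc k) \<le> b k * (\<rho> + (1 - \<rho>) * b k)"
  shows "b k \<le> \<tau>"
    and "b \<longlonglongrightarrow> 0"
    and "\<rho> > 0 \<Longrightarrow> b (Suc k) \<le> \<rho> ^ k * (\<tau> * (1 - \<tau>) powr (- 1 / \<rho>))"
proof -
  define q where "q = \<rho> + (1 - \<rho>) * \<tau>"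
  have \<tau>: "0 \<le> \<tau>" using nonneg b0 by metis
  have q: "0 \<le> q" "q < 1"
  proof -
    show "0 \<le> q" using assms \<tau> by (auto simp: q_def)
    have "(1 - \<rho>) * \<tau> < (1 - \<rho>) * 1" using assms by (intro mult_strict_left_mono) auto
    then show "q < 1" by (simp add: q_def)
  qed
  have qle: "q ^ k * \<tau> \<le> \<tau>" for k
    using q \<tau> by (simp add: mult_left_le_one_le power_le_one)
  have geo: "b (Suc k) \<le> q ^ k * \<tau>" for k
  proof (induction k)
    case 0
    then show ?case using b1 by simp
  next
    case (Suc k)
    have le: "b (Suc k) \<le> \<tau>"
      using Suc qle[of k] by simp
    have "b (Suc (Suc k)) \<le> b (Suc k) * (\<rho> + (1 - \<rho>) * b (Suc k))" by (rule rec) simp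
    also have "\<dots> \<le> (q ^ k * \<tau>) * q"
      unfolding q_def using Suc le assms \<tau> nonneg q
      by (intro mult_mono add_mono mult_left_mono) (auto simp: q_def)
    finally show ?case by (simp add: mult_ac)
  qed
  show le: "b k \<le> \<tau>" for k
  proof (cases k)
    case (Suc j)
    then show ?thesis using geo[of j] qle[of j] by simp
  qed (use b0 in simp)
  have "(\<lambda>k. q ^ k * \<tau>) \<longlonglongrightarrow> 0 * \<tau>"
    using q by (intro tendsto_mult LIMSEQ_power_zero tendsto_const) auto
  then have lim: "(\<lambda>k. q ^ k * \<tau>) \<longlonglongrightarrow> 0" by simp
  have "(\<lambda>k. b (Suc k)) \<longlonglongrightarrow> 0"
    using geo nonneg by (intro tendsto_sandwich[OF _ _ tendsto_const lim] always_eventually allI)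
  then show "b \<longlonglongrightarrow> 0" by (rule LIMSEQ_imp_Suc)
  assume \<rho>: "\<rho> > 0"
  have V: "b (Suc k) * (1 - b (Suc k)) powr (- 1 / \<rho>) \<le> \<rho> ^ k * (\<tau> * (1 - \<tau>) powr (- 1 / \<rho>))"
  proof (induction k)
    case 0
    have "b 1 * (1 - b 1) powr (- 1 / \<rho>) \<le> \<tau> * (1 - \<tau>) powr (- 1 / \<rho>)"
      using b1 \<tau> \<rho> assms nonneg by (intro mult_mono powr_mono2') auto
    then show ?case by simp
  next
    case (Suc k)
    have "b (Suc (Suc k)) * (1 - b (Suc (Suc k))) powr (- 1 / \<rho>)
        \<le> \<rho> * (b (Suc k) * (1 - b (Suc k)) powr (- 1 / \<rho>))"
      using \<rho> assms nonneg le[of "Suc k"] rec[of "Suc k"] by (intro lyapunov_step) auto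
    also have "\<dots> \<le> \<rho> * (\<rho> ^ k * (\<tau> * (1 - \<tau>) powr (- 1 / \<rho>)))"
      using Suc \<rho> by (intro mult_left_mono) auto
    finally show ?case by (simp add: mult_ac)
  qed
  have "1 powr (- 1 / \<rho>) \<le> (1 - b (Suc k)) powr (- 1 / \<rho>)"
    using \<rho> assms nonneg le[of "Suc k"] by (intro powr_mono2') auto
  then have "b (Suc k) * 1 \<le> b (Suc k) * (1 - b (Suc k)) powr (- 1 / \<rho>)"
    using nonneg by (intro mult_left_mono) auto
  then show "b (Suc k) \<le> \<rho> ^ k * (\<tau> * (1 - \<tau>) powr (- 1 / \<rho>))" using V by simp
qed

text \<open>The endpoints are chosen so that \<open>1 - g = (1 - \<rho>) * (1 - \<tau>)\<close>,
  which reduces the ratio of the previous estimate to \<open>1 / (1 - \<tau>)\<close>. Subtracting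
  \<open>1\<close> removes the share of the first step.\<close>

lemma rate_offset_bound:
  fixes \<rho> \<tau> :: real
  assumes "0 < \<rho>" "\<rho> < 1" "0 \<le> \<tau>" "\<tau> < 1"
  shows "ln (1 / (1 - \<tau>)) / \<rho> \<le> (rate_offset \<rho> \<tau> - 1) * ln (1 / \<rho>)"
proof -
  define g where "g = \<rho> + \<tau> * (1 - \<rho>)"
  have g: "\<rho> \<le> g" "g < 1"
  proof -
    show "\<rho> \<le> g" using assms by (auto simp: g_def)
    have "\<tau> * (1 - \<rho>) < 1 * (1 - \<rho>)" using assms by (intro mult_strict_right_mono) auto
    then show "g < 1" by (simp add: g_def)
  qed
  have ln: "0 < ln (1 / g)" "ln (1 / g) \<le> ln (1 / \<rho>)"
    using g assms by (auto simp: field_simps)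
  have "exp (- ln (1 / \<rho>)) = \<rho>" "exp (- ln (1 / g)) = g"
    using g assms by (auto simp: ln_div)
  then have "ln ((1 - \<rho>) / (1 - g)) \<le> exp_integral_E1 (ln (1 / g)) - exp_integral_E1 (ln (1 / \<rho>))
      + 1 / 2 * ln (ln (1 / \<rho>) / ln (1 / g))"
    using log_ratio_le_E1_diff[OF ln] by simp
  moreover have "(1 - \<rho>) / (1 - g) = 1 / (1 - \<tau>)"
  proof -
    have "1 - g = (1 - \<rho>) * (1 - \<tau>)" by (simp add: g_def algebra_simps)
    then show ?thesis using assms by simp
  qed
  ultimately have "ln (1 / (1 - \<tau>)) \<le> exp_integral_E1 (ln (1 / g)) - exp_integral_E1 (ln (1 / \<rho>))
      + 1 / 2 * ln (ln (1 / \<rho>) / ln (1 / g))" (is "_ \<le> ?S") by simp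
  moreover have "(rate_offset \<rho> \<tau> - 1) * ln (1 / \<rho>) = ?S / \<rho>"
    using ln by (simp add: rate_offset_def g_def[symmetric])
  ultimately show ?thesis using assms by (simp add: divide_right_mono)
qed

lemma recursion_rate:
  fixes \<rho> \<tau> \<epsilon> :: real and b :: "nat \<Rightarrow> real"
  assumes \<rho>: "0 < \<rho>" "\<rho> < 1" and "\<tau> < 1"
    and nonneg: "\<And>k. 0 \<le> b k" and b0: "b 0 = \<tau>" and b1: "b 1 \<le> \<tau>"
    and rec: "\<And>k. 1 \<le> k \<Longrightarrow> b (Suc k) \<le> b k * (\<rho> + (1 - \<rho>) * b k)"
    and \<epsilon>: "\<epsilon> > 0" and k: "real k \<ge> ln (1 / \<epsilon>) / ln (1 / \<rho>) + rate_offset \<rho> \<tau>"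
  shows "b k \<le> \<epsilon> * \<tau>"
proof -
  define L where "L = ln (1 / \<rho>)"
  have L: "0 < L" "ln \<rho> = - L" using \<rho> by (auto simp: L_def ln_div)
  have \<tau>: "0 \<le> \<tau>" using nonneg b0 by metis
  have off: "ln (1 / (1 - \<tau>)) / \<rho> \<le> (rate_offset \<rho> \<tau> - 1) * L"
    unfolding L_def using \<rho> \<tau> assms by (intro rate_offset_bound) auto
  have pos: "0 \<le> ln (1 / (1 - \<tau>))" using \<tau> assms by simp
  have "ln (1 / \<epsilon>) / L \<le> real k - rate_offset \<rho> \<tau>" using k by (simp add: L_def)
  then have "ln (1 / \<epsilon>) \<le> (real k - rate_offset \<rho> \<tau>) * L" using L by (simp add: field_simps)
  \<comment> \<open>For positive \<open>k\<close> this is the logarithm of \<open>\<rho> ^ (k - 1) *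
    (1 - \<tau>) powr (- 1 / \<rho>) \<le> \<epsilon>\<close>. For \<open>k = 0\<close> it forces
    \<open>1 \<le> \<epsilon>\<close>.\<close>
  then have \<epsilon>': "ln (1 / (1 - \<tau>)) / \<rho> - (real k - 1) * L \<le> ln \<epsilon>"
    using off \<epsilon> by (simp add: ln_div algebra_simps)
  show ?thesis
  proof (cases k)
    case 0
    have "0 \<le> ln (1 / (1 - \<tau>)) / \<rho>" using pos \<rho> by simp
    then have "0 \<le> ln \<epsilon>" using \<epsilon>' 0 L by simp
    then have "1 \<le> \<epsilon>" using \<epsilon> by (simp add: ln_ge_zero_iff)
    then have "1 * \<tau> \<le> \<epsilon> * \<tau>" using \<tau> by (intro mult_right_mono)
    then show ?thesis using 0 b0 by simp
  next
    case (Suc j)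
    have "\<rho> ^ j * (1 - \<tau>) powr (- 1 / \<rho>) = exp (ln (1 / (1 - \<tau>)) / \<rho> - real j * L)"
    proof -
      have "\<rho> ^ j = exp (- (real j * L))"
        using \<rho> L by (simp add: powr_realpow[symmetric] powr_def)
      moreover have "(1 - \<tau>) powr (- 1 / \<rho>) = exp (ln (1 / (1 - \<tau>)) / \<rho>)"
        using assms by (simp add: powr_def ln_div)
      ultimately show ?thesis by (simp add: exp_diff exp_minus field_simps)
    qed
    also have "\<dots> \<le> exp (ln \<epsilon>)" using \<epsilon>' Suc by simp
    finally have "\<rho> ^ j * (1 - \<tau>) powr (- 1 / \<rho>) \<le> \<epsilon>" using \<epsilon> by simp
    then have "\<rho> ^ j * (1 - \<tau>) powr (- 1 / \<rho>) * \<tau> \<le> \<epsilon> * \<tau>" using \<tau> by (intro mult_right_mono)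
    moreover have "b (Suc j) \<le> \<rho> ^ j * (\<tau> * (1 - \<tau>) powr (- 1 / \<rho>))"
      by (rule recursion_bounds(3)) (use assms in auto)
    ultimately show ?thesis using Suc by (simp add: mult_ac)
  qed
qed

section \<open>The compressed projection and the iteration\<close>

text \<open>\<open>LEAST\<close> over the reals is informative only if a least eigenvalue exists; a
  minimizer of the Rayleigh quotient on the compact unit sphere supplies it.\<close>

lemma min_eigenvalue_symmetric:
  fixes A :: "real ^ 'n ^ 'n"
  assumes sym: "transpose A = A"
  shows "is_eigenvalue A (min_eigenvalue A)"
    and "min_eigenvalue A * (norm x)\<^sup>2 \<le> x \<bullet> (A *v x)"
proof -
  let ?f = "\<lambda>x. x \<bullet> (A *v x)"
  have adj: "x \<bullet> (A *v y) = y \<bullet> (A *v x)" for x y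
    by (metis dot_lmul_matrix inner_commute sym transpose_matrix_vector)
  have "continuous_on (sphere 0 1) ?f" by (intro continuous_intros matrix_vector_mult_linear_continuous_on)
  moreover have "axis undefined 1 \<in> sphere (0 :: real ^ 'n) 1" by simp
  then have "sphere (0 :: real ^ 'n) 1 \<noteq> {}" by blast
  ultimately obtain x0 where x0: "x0 \<in> sphere 0 1" "\<And>x. x \<in> sphere 0 1 \<Longrightarrow> ?f x0 \<le> ?f x"
    using continuous_attains_inf[of "sphere 0 1" ?f] by auto
  define m where "m = ?f x0"
  have n0: "x0 \<noteq> 0" "x0 \<bullet> x0 = 1" using x0 by (auto simp: norm_eq_1)
  have ray: "m * (norm x)\<^sup>2 \<le> ?f x" for x
  proof (cases "x = 0")
    case False
    have "m \<le> ?f (x /\<^sub>R norm x)" unfolding m_def using False by (intro x0) simp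
    also have "\<dots> = ?f x / (norm x)\<^sup>2"
      by (simp add: matrix_vector_mult_scaleR power2_eq_square divide_inverse mult_ac)
    finally show ?thesis using False by (simp add: pos_le_divide_eq)
  qed simp
  define y where "y = A *v x0 - m *\<^sub>R x0"
  define \<beta> where "\<beta> = ?f y - m * (norm y)\<^sup>2"
  have \<beta>: "0 \<le> \<beta>" using ray by (simp add: \<beta>_def)
  \<comment> \<open>First variation in the direction of the residual \<open>y\<close>: its linear
    coefficient is \<open>2 * (norm y)^2\<close>, so a small negative \<open>t\<close> contradicts
    minimality unless \<open>y = 0\<close>.\<close>
  have pert: "0 \<le> 2 * t * (norm y)\<^sup>2 + t\<^sup>2 * \<beta>" for t
  proof -
    have e1: "?f (x0 + t *\<^sub>R y) = m + 2 * t * (y \<bullet> (A *v x0)) + t\<^sup>2 * ?f y"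
      by (simp add: matrix_vector_right_distrib matrix_vector_mult_scaleR inner_add_left inner_add_right
          adj[of x0 y] m_def power2_eq_square algebra_simps)
    have e2: "(norm (x0 + t *\<^sub>R y))\<^sup>2 = 1 + 2 * t * (y \<bullet> x0) + t\<^sup>2 * (norm y)\<^sup>2"
      unfolding power2_norm_eq_inner
      by (simp add: inner_add_left inner_add_right inner_commute n0 power2_eq_square algebra_simps)
    have e3: "(norm y)\<^sup>2 = y \<bullet> (A *v x0) - m * (y \<bullet> x0)"
      by (simp add: power2_norm_eq_inner y_def inner_diff_right)
    have "?f (x0 + t *\<^sub>R y) - m * (norm (x0 + t *\<^sub>R y))\<^sup>2 = 2 * t * (norm y)\<^sup>2 + t\<^sup>2 * \<beta>"
      unfolding e1 e2 e3 \<beta>_def by (simp add: algebra_simps)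
    then show ?thesis using ray[of "x0 + t *\<^sub>R y"] by simp
  qed
  have "y = 0"
  proof (rule ccontr)
    assume "y \<noteq> 0"
    then have a: "0 < (norm y)\<^sup>2" by simp
    \<comment> \<open>Small enough for the linear term to dominate; adding \<open>1\<close> keeps
      the denominator positive when \<open>\<beta> = 0\<close>.\<close>
    define s where "s = (norm y)\<^sup>2 / (\<beta> + 1)"
    have s: "0 < s" "s * \<beta> < 2 * (norm y)\<^sup>2"
    proof -
      show s0: "0 < s" using a \<beta> by (simp add: s_def)
      have "s * (\<beta> + 1) = (norm y)\<^sup>2" using \<beta> by (simp add: s_def)
      then have "s * \<beta> + s = (norm y)\<^sup>2" by (simp add: distrib_left)
      then show "s * \<beta> < 2 * (norm y)\<^sup>2" using s0 a by linarith
    qed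
    have "0 \<le> s * (s * \<beta> - 2 * (norm y)\<^sup>2)"
      using pert[of "- s"] by (simp add: power2_eq_square algebra_simps)
    then show False using s by (simp add: zero_le_mult_iff)
  qed
  then have eig: "is_eigenvalue A m" using n0 by (auto simp: is_eigenvalue_def y_def intro!: exI[of _ x0])
  moreover have "m \<le> \<nu>" if ev: "is_eigenvalue A \<nu>" for \<nu>
  proof -
    obtain x where x: "x \<noteq> 0" "A *v x = \<nu> *\<^sub>R x" using ev by (auto simp: is_eigenvalue_def)
    have "m * (norm x)\<^sup>2 \<le> \<nu> * (norm x)\<^sup>2" using ray[of x] x by (simp add: power2_norm_eq_inner)
    then show ?thesis using x by simp
  qed
  ultimately have "min_eigenvalue A = m" unfolding min_eigenvalue_def by (intro Least_equality)
  then show "is_eigenvalue A (min_eigenvalue A)" "min_eigenvalue A * (norm x)\<^sup>2 \<le> x \<bullet> (A *v x)"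
    using eig ray by auto
qed

section \<open>Vectorization and Kronecker products\<close>

lemma kronecker_vectorize:
  fixes W :: "real ^ 'n ^ 'm"
  shows "kronecker B A *v vectorize W = vectorize (A ** W ** transpose B)"
proof -
  have "(kronecker B A *v vectorize W) $ (j, i) = vectorize (A ** W ** transpose B) $ (j, i)" for i j
  proof -
    have "(kronecker B A *v vectorize W) $ (j, i)
        = (\<Sum>l\<in>UNIV. \<Sum>k\<in>UNIV. B $ j $ l * A $ i $ k * W $ k $ l)"
      by (simp add: matrix_vector_mult_def kronecker_def vectorize_def UNIV_Times_UNIV[symmetric]
          sum.cartesian_product split_beta del: UNIV_Times_UNIV)
    also have "\<dots> = vectorize (A ** W ** transpose B) $ (j, i)"
      by (simp add: vectorize_def matrix_matrix_mult_def transpose_def sum_distrib_left mult_ac)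
    finally show ?thesis .
  qed
  then show ?thesis by (simp add: vec_eq_iff)
qed

lemma inner_vectorize:
  fixes A B :: "real ^ 'n ^ 'm"
  shows "vectorize A \<bullet> vectorize B = A \<bullet> B"
proof -
  have "vectorize A \<bullet> vectorize B = (\<Sum>j\<in>UNIV. \<Sum>i\<in>UNIV. A $ i $ j * B $ i $ j)"
    by (simp add: inner_vec_def vectorize_def UNIV_Times_UNIV[symmetric]
        sum.cartesian_product split_beta del: UNIV_Times_UNIV)
  also have "\<dots> = A \<bullet> B" unfolding inner_vec_def by simp (rule sum.swap)
  finally show ?thesis .
qed

lemma vectorize_surj: "\<exists>W :: real ^ 'n ^ 'm. vectorize W = y"
  by (rule exI[of _ "\<chi> i j. y $ (j, i)"]) (simp add: vectorize_def vec_eq_iff)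

lemma transpose_kronecker: "transpose (kronecker A B) = kronecker (transpose A) (transpose B)"
  by (simp add: transpose_def kronecker_def vec_eq_iff)

text \<open>Self-adjointness and idempotence of \<open>W \<mapsto> P ** W ** Q\<close> in one
  identity.\<close>

lemma norm_sandwich_inner:
  assumes "orth_proj P" "orth_proj Q"
  shows "(P ** W ** Q) \<bullet> Z = (P ** W ** Q) \<bullet> (P ** Z ** Q)"
proof -
  let ?X = "P ** W ** Q"
  have P: "transpose P = P" "P ** P = P" and Q: "transpose Q = Q" "Q ** Q = Q"
    using assms by (auto simp: orth_proj_def)
  have XQ: "?X ** Q = ?X" using Q by (simp add: matrix_mul_assoc[symmetric])
  have PX: "P ** ?X = ?X" using P by (simp add: matrix_mul_assoc)
  have "?X \<bullet> (P ** Z ** Q) = ?X \<bullet> (P ** Z)"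
    using inner_matrix_mult_right[of ?X Q "P ** Z"] unfolding XQ Q by simp
  also have "\<dots> = ?X \<bullet> Z"
    using inner_matrix_mult_left[of P ?X Z] unfolding PX P by simp
  finally show ?thesis by simp
qed

section \<open>Entry projections and their interplay with the tangent space\<close>

lemma entry_proj_diff: "entry_proj \<Omega> (A - B) = entry_proj \<Omega> A - entry_proj \<Omega> B"
  by (simp add: entry_proj_def vec_eq_iff)

lemma entry_proj_add: "entry_proj \<Omega> (A + B) = entry_proj \<Omega> A + entry_proj \<Omega> B"
  by (simp add: entry_proj_def vec_eq_iff)

lemma entry_proj_compl: "entry_proj (- \<Omega>) A + entry_proj \<Omega> A = A"
  by (simp add: entry_proj_def vec_eq_iff)

lemma entry_proj_idem: "entry_proj \<Omega> (entry_proj \<Omega> A) = entry_proj \<Omega> A"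
  by (simp add: entry_proj_def vec_eq_iff)

lemma inner_entry_proj: "entry_proj \<Omega> A \<bullet> B = entry_proj \<Omega> A \<bullet> entry_proj \<Omega> B"
  unfolding inner_vec_def by (intro sum.cong refl) (simp add: entry_proj_def)

lemma norm_entry_proj_le: "norm (entry_proj \<Omega> A) \<le> norm A"
proof (cases "entry_proj \<Omega> A = 0")
  case False
  have "norm (entry_proj \<Omega> A) * norm (entry_proj \<Omega> A) \<le> norm (entry_proj \<Omega> A) * norm A"
    using norm_cauchy_schwarz[of "entry_proj \<Omega> A" A] inner_entry_proj[of \<Omega> A A]
    by (simp add: dot_square_norm power2_eq_square)
  then show ?thesis using False by simp
qed simp

text \<open>\<open>S\<close> is an isometric coordinate map onto the matrices supported on
  \<open>I\<close>. In these coordinates \<open>H\<close> is the compression of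
  \<open>W \<mapsto> P ** W ** Q\<close>, with quadratic form
  \<open>(norm (P ** W ** Q))^2\<close>.\<close>

lemma compressed_min_eigenvalue:
  fixes S :: "real ^ 'p ^ ('n2::finite \<times> 'n1::finite)" and P :: "real ^ 'n1 ^ 'n1" and Q :: "real ^ 'n2 ^ 'n2"
  assumes P: "orth_proj P" and Q: "orth_proj Q" and S: "is_selection_matrix I S"
  defines "H \<equiv> transpose S ** kronecker Q P ** S"
  shows "min_eigenvalue H \<le> 1"
    and "entry_proj I W = W \<Longrightarrow> min_eigenvalue H * (norm W)\<^sup>2 \<le> (norm (P ** W ** Q))\<^sup>2"
proof -
  have St: "transpose P = P" "transpose Q = Q" using P Q by (auto simp: orth_proj_def)
  have SS: "transpose S ** S = mat 1"
    and Sv: "\<And>X. vectorize (entry_proj I X) = (S ** transpose S) *v vectorize X"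
    using S by (auto simp: is_selection_matrix_def)
  have sym: "transpose H = H"
    by (simp add: H_def matrix_transpose_mul transpose_kronecker St matrix_mul_assoc)
  have form: "x \<bullet> (H *v x) = (norm (P ** W ** Q))\<^sup>2" if "S *v x = vectorize W" for x W
  proof -
    have "x \<bullet> (H *v x) = (S *v x) \<bullet> (kronecker Q P *v (S *v x))"
      unfolding H_def matrix_vector_mul_assoc[symmetric]
      by (metis dot_lmul_matrix inner_commute transpose_matrix_vector)
    also have "\<dots> = W \<bullet> (P ** W ** Q)"
      by (simp add: that kronecker_vectorize inner_vectorize St)
    also have "\<dots> = (norm (P ** W ** Q))\<^sup>2"
      using norm_sandwich_inner[OF P Q, of W W] by (simp add: power2_norm_eq_inner inner_commute)
    finally show ?thesis .
  qed
  have iso: "norm x = norm W" if "S *v x = vectorize W" for x W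
  proof -
    have "x \<bullet> x = (S *v x) \<bullet> (S *v x)"
      using SS by (metis dot_lmul_matrix matrix_vector_mul_assoc matrix_vector_mul_lid transpose_matrix_vector)
    then show ?thesis by (simp add: that inner_vectorize norm_eq_sqrt_inner)
  qed
  obtain x where x: "x \<noteq> 0" "H *v x = min_eigenvalue H *\<^sub>R x"
    using min_eigenvalue_symmetric(1)[OF sym] by (auto simp: is_eigenvalue_def)
  obtain V :: "real ^ 'n2 ^ 'n1" where V: "vectorize V = S *v x" using vectorize_surj by blast
  have "min_eigenvalue H * (norm x)\<^sup>2 = (norm (P ** V ** Q))\<^sup>2"
    using form[OF V[symmetric]] x by (simp add: power2_norm_eq_inner)
  also have "\<dots> \<le> (norm V)\<^sup>2" using norm_orth_proj_sandwich_le[OF P Q] by (intro power_mono) auto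
  also have "\<dots> = 1 * (norm x)\<^sup>2" using iso[OF V[symmetric]] by simp
  finally show "min_eigenvalue H \<le> 1" by (rule mult_right_le_imp_le) (use x in simp)
  show "min_eigenvalue H * (norm W)\<^sup>2 \<le> (norm (P ** W ** Q))\<^sup>2" if "entry_proj I W = W"
  proof -
    define y where "y = transpose S *v vectorize W"
    have "S *v y = vectorize W"
      using Sv[of W] that unfolding y_def matrix_vector_mul_assoc by simp
    then show ?thesis using min_eigenvalue_symmetric(2)[OF sym, of y] form iso by metis
  qed
qed

lemma inner_tangent_normal:
  assumes P: "orth_proj P" and Q: "orth_proj Q"
  shows "W \<bullet> Z \<le> norm (W - P ** W ** Q) * norm (Z - P ** Z ** Q) + norm (P ** W ** Q) * norm (P ** Z ** Q)"
proof -
  have "W \<bullet> Z = (W - P ** W ** Q) \<bullet> (Z - P ** Z ** Q) + (P ** W ** Q) \<bullet> (P ** Z ** Q)"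
    using norm_sandwich_inner[OF P Q, of W Z] norm_sandwich_inner[OF P Q, of Z W]
    by (simp add: inner_diff_left inner_diff_right inner_commute)
  then show ?thesis
    using norm_cauchy_schwarz[of "W - P ** W ** Q" "Z - P ** Z ** Q"] norm_cauchy_schwarz[of "P ** W ** Q" "P ** Z ** Q"]
    by linarith
qed

lemma norm_tangent:
  assumes P: "orth_proj P" and Q: "orth_proj Q"
  shows "(norm (W - P ** W ** Q))\<^sup>2 = (norm W)\<^sup>2 - (norm (P ** W ** Q))\<^sup>2"
  using norm_sandwich_inner[OF P Q, of W W]
  by (simp add: power2_norm_eq_inner inner_diff_left inner_diff_right inner_commute)

text \<open>The third claim is dual to the second: \<open>entry_proj I Z\<close> is tested against
  \<open>Z\<close>, and its tangent part is the factor that shrinks. The fourth applies both, since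
  the tangent part of \<open>Z\<close> has no normal component.\<close>

lemma tangent_contraction:
  fixes S :: "real ^ 'p ^ ('n2::finite \<times> 'n1::finite)" and P :: "real ^ 'n1 ^ 'n1" and Q :: "real ^ 'n2 ^ 'n2"
  assumes P: "orth_proj P" and Q: "orth_proj Q" and S: "is_selection_matrix I S"
  defines "\<rho> \<equiv> 1 - min_eigenvalue (transpose S ** kronecker Q P ** S)"
  shows "0 \<le> \<rho>"
    and "entry_proj I W = W \<Longrightarrow> norm (W - P ** W ** Q) \<le> sqrt \<rho> * norm W"
    and "norm (entry_proj I Z) \<le> sqrt \<rho> * norm (Z - P ** Z ** Q) + norm (P ** Z ** Q)"
    and "entry_proj I Z = Z \<Longrightarrow> norm (entry_proj I (Z - P ** Z ** Q)) \<le> \<rho> * norm Z"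
proof -
  note E = compressed_min_eigenvalue[OF P Q S]
  show \<rho>: "0 \<le> \<rho>" using E(1) by (simp add: \<rho>_def)
  show tan: "norm (W - P ** W ** Q) \<le> sqrt \<rho> * norm W" if "entry_proj I W = W" for W
  proof (rule power2_le_imp_le)
    show "(norm (W - P ** W ** Q))\<^sup>2 \<le> (sqrt \<rho> * norm W)\<^sup>2"
      using E(2)[OF that] \<rho> unfolding norm_tangent[OF P Q] \<rho>_def
      by (simp add: power_mult_distrib left_diff_distrib)
  qed (use \<rho> in simp)
  have main: "norm (entry_proj I Z) \<le> sqrt \<rho> * norm (Z - P ** Z ** Q) + norm (P ** Z ** Q)" for Z
  proof (cases "entry_proj I Z = 0")
    case False
    let ?W = "entry_proj I Z"
    have "norm ?W * norm ?W = ?W \<bullet> Z"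
      using inner_entry_proj[of I Z Z] by (simp add: dot_square_norm power2_eq_square)
    also have "\<dots> \<le> norm (?W - P ** ?W ** Q) * norm (Z - P ** Z ** Q) + norm (P ** ?W ** Q) * norm (P ** Z ** Q)"
      by (rule inner_tangent_normal[OF P Q])
    also have "\<dots> \<le> (sqrt \<rho> * norm ?W) * norm (Z - P ** Z ** Q) + norm ?W * norm (P ** Z ** Q)"
      by (intro add_mono mult_right_mono tan norm_orth_proj_sandwich_le P Q entry_proj_idem norm_ge_zero)
    also have "\<dots> = norm ?W * (sqrt \<rho> * norm (Z - P ** Z ** Q) + norm (P ** Z ** Q))"
      by (simp add: algebra_simps)
    finally show ?thesis using False by simp
  qed (use \<rho> in simp)
  then show "norm (entry_proj I Z) \<le> sqrt \<rho> * norm (Z - P ** Z ** Q) + norm (P ** Z ** Q)" .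
  show "norm (entry_proj I (Z - P ** Z ** Q)) \<le> \<rho> * norm Z" if Z: "entry_proj I Z = Z"
  proof -
    let ?T = "Z - P ** Z ** Q"
    have "P ** (P ** Z ** Q) ** Q = P ** Z ** Q"
      using P Q by (metis matrix_mul_assoc orth_proj_def)
    then have 0: "P ** ?T ** Q = 0" by (simp add: matrix_diff_ldistrib matrix_diff_rdistrib)
    have "norm (entry_proj I ?T) \<le> sqrt \<rho> * norm (?T - P ** ?T ** Q) + norm (P ** ?T ** Q)" by (rule main)
    also have "\<dots> = sqrt \<rho> * norm ?T" unfolding 0 by simp
    also have "\<dots> \<le> sqrt \<rho> * (sqrt \<rho> * norm Z)" using tan[OF Z] \<rho> by (intro mult_left_mono) auto
    also have "\<dots> = \<rho> * norm Z" using \<rho> by (simp add: mult.assoc[symmetric])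
    finally show ?thesis .
  qed
qed

theorem theorem1:
  fixes M :: "real ^ 'n2 ^ 'n1"
    and \<sigma> :: "nat \<Rightarrow> real"
    and u :: "nat \<Rightarrow> real ^ 'n1"
    and v :: "nat \<Rightarrow> real ^ 'n2"
    and \<Omega> :: "('n1 \<times> 'n2) set"
    and PU :: "real ^ 'n1 ^ 'n1"
    and PV :: "real ^ 'n2 ^ 'n2"
    and S :: "real ^ 'p ^ ('n2 \<times> 'n1)"
    and H :: "real ^ 'p ^ 'p"
    and Pr R :: "real ^ 'n2 ^ 'n1 \<Rightarrow> real ^ 'n2 ^ 'n1"
    and X :: "nat \<Rightarrow> real ^ 'n2 ^ 'n1"
    and r s :: nat
    and c1 \<rho> \<tau> :: real
  assumes r_bounds: "1 \<le> r" "r \<le> min CARD('n1) CARD('n2)"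
    and rank_M: "rank M = r"
    and svd_M: "is_compact_svd r M \<sigma> u v"
    and PU_eq: "PU = orth_complement_proj r u"
    and PV_eq: "PV = orth_complement_proj r v"
    and card_Omega: "card \<Omega> = s"
    and s_bounds: "1 \<le> s" "s < CARD('n1) * CARD('n2)"
    and card_p: "CARD('p) = CARD('n1) * CARD('n2) - s"
    and S: "is_selection_matrix (- \<Omega>) S"
    and Pr: "is_rank_projection r Pr"
    and c1_bounds: "1 + 1 / sqrt 2 \<le> c1" "c1 \<le> 4 * (1 + sqrt 2)"
    and c1_expansion: "\<And>\<Delta>. Pr (M + \<Delta>) = M + \<Delta> - PU ** \<Delta> ** PV + R \<Delta>"
    and c1_remainder: "\<And>\<Delta>. norm (R \<Delta>) \<le> c1 / \<sigma> r * (norm \<Delta>)\<^sup>2"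
    and H_eq: "H = transpose S ** kronecker PV PU ** S"
    and iteration: "\<And>k. X (Suc k) = entry_proj (- \<Omega>) (Pr (X k)) + entry_proj \<Omega> M"
    and init: "norm (X 0 - M) < min_eigenvalue H / c1 * \<sigma> r"
    and rho_eq: "\<rho> = 1 - min_eigenvalue H"
    and tau_eq: "\<tau> = c1 * norm (X 0 - M) / (\<sigma> r * min_eigenvalue H)"
  shows "asymptotically_linear \<rho> (\<lambda>k. norm (X k - M)) \<and>
         (\<rho> > 0 \<longrightarrow>
           (\<forall>\<epsilon> > 0. \<forall>k :: nat.
              real k \<ge> ln (1 / \<epsilon>) / ln (1 / (1 - min_eigenvalue H)) + rate_offset \<rho> \<tau> \<longrightarrow>
              norm (X k - M) \<le> \<epsilon> * norm (X 0 - M)))"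
proof -
  define \<delta> where "\<delta> k = norm (X k - M)" for k
  define \<mu> where "\<mu> = min_eigenvalue H"
  define T where "T = (entry_proj (- \<Omega>) :: real ^ 'n2 ^ 'n1 \<Rightarrow> _)"
  have u: "orthonormal_upto r u" and v: "orthonormal_upto r v" and sr: "0 < \<sigma> r"
    using svd_M r_bounds by (auto simp: is_compact_svd_def is_svd_def)
  have P: "orth_proj PU" and Q: "orth_proj PV"
    unfolding PU_eq PV_eq using u v by (auto intro: orth_proj_orth_complement_proj)
  have "0 < 1 / sqrt 2" by simp
  then have c1: "1 < c1" using c1_bounds by linarith
  have "0 < \<mu> / c1 * \<sigma> r" using init norm_ge_zero[of "X 0 - M"] unfolding \<mu>_def by linarith
  then have \<mu>: "0 < \<mu>" using c1 sr by (simp add: zero_less_mult_iff zero_less_divide_iff)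
  have \<rho>\<mu>: "\<rho> = 1 - \<mu>" by (simp add: rho_eq \<mu>_def)
  note C = tangent_contraction[OF P Q S, folded H_eq, folded rho_eq]
  have \<rho>: "0 \<le> \<rho>" "\<rho> < 1" using C(1) \<mu> by (auto simp: \<rho>\<mu>)

  have step: "X (Suc k) - M = T (Pr (X k) - M)" for k
    using entry_proj_compl[of \<Omega> M] unfolding T_def entry_proj_diff iteration by (simp add: algebra_simps)

  have first: "\<delta> 1 \<le> \<delta> 0"
  proof -
    let ?N = "min CARD('n1) CARD('n2)"
    let ?Z = "Pr (X 0) - M"
    obtain s a b where X0: "is_svd ?N (X 0) s a b" and Y: "Pr (X 0) = (\<Sum>i = 1..r. s i *\<^sub>R outer (a i) (b i))"
      using Pr unfolding is_rank_projection_def by blast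
    \<comment> \<open>Every matrix has a singular value decomposition because the rank projection
      \<open>Pr\<close> truncates one for each argument.\<close>
    have svds: "\<exists>s u v. is_svd ?N A s u v" for A :: "real ^ 'n2 ^ 'n1"
      using Pr unfolding is_rank_projection_def by blast
    define k where "k = c1 * (\<delta> 0)\<^sup>2 / (2 * \<sigma> r)"
    have close: "c1 * \<delta> 0 < \<mu> * \<sigma> r"
      using init c1 by (simp add: \<delta>_def \<mu>_def field_simps)
    also have "\<dots> \<le> \<sigma> r" using \<rho> sr by (simp add: \<rho>\<mu>)
    finally have "c1 * norm (X 0 - M) < \<sigma> r" by (simp add: \<delta>_def)
    note B = truncation_error_bound[OF svd_M r_bounds X0 svds c1_bounds(1) this,
        folded Y PU_eq PV_eq, folded \<delta>_def, folded k_def]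
    have "sqrt \<rho> * norm (?Z - PU ** ?Z ** PV) + norm (PU ** ?Z ** PV) \<le> \<delta> 0"
    proof (rule tangent_normal_sum_numeric)
      show "0 \<le> sqrt \<rho>" "sqrt \<rho> \<le> 1" "0 \<le> \<delta> 0" using \<rho> by (auto simp: \<delta>_def)
      show "(norm (?Z - PU ** ?Z ** PV))\<^sup>2 + (norm (PU ** ?Z ** PV))\<^sup>2 \<le> (\<delta> 0)\<^sup>2 + k\<^sup>2"
        using B(1) unfolding norm_tangent[OF P Q] by simp
      show "norm (PU ** ?Z ** PV) \<le> k" by (rule B(2))
      \<comment> \<open>The denominator \<open>2\<close> in \<open>k\<close> absorbs the factor
        \<open>1 + sqrt \<rho>\<close> of
        \<open>\<mu> = (1 - sqrt \<rho>) * (1 + sqrt \<rho>)\<close>.\<close>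
      have "k = (c1 * \<delta> 0) * (\<delta> 0 / (2 * \<sigma> r))" by (simp add: k_def power2_eq_square)
      also have "\<dots> \<le> (\<mu> * \<sigma> r) * (\<delta> 0 / (2 * \<sigma> r))"
        using close sr by (intro mult_right_mono) (auto simp: \<delta>_def)
      also have "\<dots> = \<mu> / 2 * \<delta> 0" using sr by simp
      also have "\<dots> \<le> (1 - sqrt \<rho>) * \<delta> 0"
      proof (rule mult_right_mono)
        have "\<mu> = (1 - sqrt \<rho>) * (1 + sqrt \<rho>)" using \<rho> by (simp add: algebra_simps \<rho>\<mu>)
        also have "\<dots> \<le> (1 - sqrt \<rho>) * 2" using \<rho> by (intro mult_left_mono) auto
        finally show "\<mu> / 2 \<le> 1 - sqrt \<rho>" by simp
      qed (simp add: \<delta>_def)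
      finally show "k \<le> (1 - sqrt \<rho>) * \<delta> 0" .
    qed (simp_all)
    then show ?thesis using C(3)[of ?Z] step[of 0] by (simp add: \<delta>_def T_def)
  qed
  have later: "\<delta> (Suc k) \<le> \<rho> * \<delta> k + c1 / \<sigma> r * (\<delta> k)\<^sup>2" if k: "1 \<le> k" for k
  proof -
    let ?D = "X k - M"
    obtain j where j: "k = Suc j" using k by (cases k) auto
    have supp: "entry_proj (- \<Omega>) ?D = ?D" unfolding j step T_def entry_proj_idem ..
    have d: "Pr (X k) - M = (?D - PU ** ?D ** PV) + R ?D" using c1_expansion[of ?D] by simp
    have "X (Suc k) - M = T (?D - PU ** ?D ** PV) + T (R ?D)"
      unfolding step d T_def entry_proj_add ..
    then have "\<delta> (Suc k) \<le> norm (T (?D - PU ** ?D ** PV)) + norm (T (R ?D))"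
      unfolding \<delta>_def using norm_triangle_ineq by metis
    also have "\<dots> \<le> \<rho> * norm ?D + c1 / \<sigma> r * (norm ?D)\<^sup>2"
      using C(4)[OF supp] norm_entry_proj_le[of "- \<Omega>" "R ?D"] c1_remainder[of ?D] unfolding T_def by linarith
    finally show ?thesis by (simp add: \<delta>_def)
  qed

  \<comment> \<open>This scaling moves the nonzero fixed point of the scalar recursion to
    \<open>1\<close>, so the initial condition becomes \<open>\<tau> < 1\<close>.\<close>
  define c where "c = c1 / (\<sigma> r * \<mu>)"
  define b where "b k = c * \<delta> k" for k
  have c: "0 < c" using c1 sr \<mu> by (simp add: c_def)
  have b_nonneg: "0 \<le> b k" for k using c by (simp add: b_def \<delta>_def)
  have b0: "b 0 = \<tau>" by (simp add: b_def c_def tau_eq \<delta>_def \<mu>_def)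
  have \<tau>: "\<tau> < 1"
    using init c1 sr \<mu> unfolding b0[symmetric] b_def c_def by (simp add: \<delta>_def \<mu>_def field_simps)
  have b1: "b 1 \<le> \<tau>" unfolding b0[symmetric] b_def using first c by (intro mult_left_mono) auto
  have cl: "c1 / \<sigma> r = (1 - \<rho>) * c" using \<mu> by (simp add: c_def \<rho>\<mu>)
  have contr: "\<delta> (Suc k) \<le> (\<rho> + (1 - \<rho>) * b k) * \<delta> k" if "1 \<le> k" for k
    using later[OF that] unfolding cl b_def by (simp add: power2_eq_square algebra_simps)
  have b_rec: "b (Suc k) \<le> b k * (\<rho> + (1 - \<rho>) * b k)" if "1 \<le> k" for k
    using mult_left_mono[OF contr[OF that], of c] c unfolding b_def by (simp add: mult_ac)
  note rb = recursion_bounds[OF \<rho>(2,1) \<tau> b_nonneg b0 b1 b_rec]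

  have "asymptotically_linear \<rho> (\<lambda>k. norm (X k - M))"
    unfolding asymptotically_linear_def \<delta>_def[symmetric]
  proof (intro conjI allI impI)
    have "(\<lambda>k. b k / c) \<longlonglongrightarrow> 0 / c" using rb(2) c by (intro tendsto_divide tendsto_const) auto
    then show "\<delta> \<longlonglongrightarrow> 0" using c by (simp add: b_def)
    fix q assume q: "\<rho> < q"
    \<comment> \<open>The contraction factor depends on the current error and tends to \<rho> along
      the iteration.\<close>
    have "(\<lambda>k. \<rho> + (1 - \<rho>) * b k) \<longlonglongrightarrow> \<rho> + (1 - \<rho>) * 0"
      by (intro tendsto_add tendsto_mult tendsto_const rb(2))
    then have "(\<lambda>k. \<rho> + (1 - \<rho>) * b k) \<longlonglongrightarrow> \<rho>" by simp
    then have "\<forall>\<^sub>F k in sequentially. \<rho> + (1 - \<rho>) * b k < q" using q by (rule order_tendstoD)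
    then show "\<forall>\<^sub>F k in sequentially. \<delta> (Suc k) \<le> q * \<delta> k"
      using eventually_ge_at_top[of 1]
    proof eventually_elim
      case (elim k)
      have "(\<rho> + (1 - \<rho>) * b k) * \<delta> k \<le> q * \<delta> k" using elim by (intro mult_right_mono) (auto simp: \<delta>_def)
      then show ?case using contr[OF elim(2)] by simp
    qed
  qed
  moreover have "norm (X k - M) \<le> \<epsilon> * norm (X 0 - M)"
    if "\<rho> > 0" "\<epsilon> > 0" and k: "real k \<ge> ln (1 / \<epsilon>) / ln (1 / (1 - min_eigenvalue H)) + rate_offset \<rho> \<tau>"
    for \<epsilon> and k :: nat
  proof -
    have "b k \<le> \<epsilon> * \<tau>"
      by (rule recursion_rate[OF \<open>\<rho> > 0\<close> \<rho>(2) \<tau> b_nonneg b0 b1 b_rec \<open>\<epsilon> > 0\<close> k[folded rho_eq]])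
    then have "c * \<delta> k \<le> c * (\<epsilon> * \<delta> 0)" unfolding b0[symmetric] by (simp add: b_def mult_ac)
    then show ?thesis using c by (simp add: \<delta>_def)
  qed
  ultimately show ?thesis by blast
qed

end
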